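(* Assume that $\Gamma_A\ne\varnothing$ or $\Gamma_B\neq\varnothing$. Let $x_1<\dots<x_s$ be the points of $\bigl((\operatorname{Spec}(A)\cup\operatorname{Spec}(A_{\bot,\bot}))\setminus\widetilde\Gamma_A\bigr)\cup\Delta_A$, enumerated in increasing order without account of multiplicities, and let $y_1<\dots<y_t$ be the points of $\bigl((\operatorname{Spec}(B)\cup\operatorname{Spec}(B_{\bot,\bot}))\setminus\widetilde\Gamma_B\bigr)\cup\Delta_B$, enumerated in the same way. Put $x_0=y_0=-\infty$, $x_{s+1}=y_{t+1}=+\infty$, and $R_{p,q}=(x_{p-1},x_p)\times(y_{q-1},y_q)$ for $p=1,\dots,s+1$, $q=1,\dots,t+1$. Then all the real pair-eigenvalues $(\alpha,\beta)$ of $M$ lie either on the straight lines $(\Gamma_A\times\mathbb R)\cup(\mathbb R\times\Gamma_B)$ or on a family of curves $(\alpha,\beta(\alpha))$ with the following properties: (a) each curve may pass only through rectangles $R_{p,q}$ with $p+q$ even; (b) each curve may cross from rectangle to rectangle only through the corner points $(x_i,y_j)$ with $i+j$ odd; (c) each curve $\beta(\alpha)$ is continuous in $\alpha$ except at eigenvalues of $A$ not belonging to $\widetilde\Gamma_A$; at each such eigenvalue $\alpha_i$ of $A$ exactly one curve blows up, in the sense that $\beta(\alpha)\to+\infty$ as $\alpha\to\alpha_i+0$ and $\beta(\alpha)\to-\infty$ as $\alpha\to\alpha_i-0$; (d) each curve $\beta(\alpha)$ is monotone decreasing in $\alpha$ on its domain of continuity, with $$\frac{d\beta}{d\alpha}=-\kappa^2\,\frac{\langle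 (A-\alpha)^{-2}\mathbf z,\mathbf z\rangle\,\bigl(\langle (B-\beta)^{-1}\mathbf z,\mathbf z\rangle\bigr)^2}{\langle (B-\beta)^{-2}\mathbf z,\mathbf z\rangle}<0,$$ the formula being understood at points with $\alpha\notin\operatorname{Spec}(A)$, $\beta\notin\operatorname{Spec}(B)$.
   Context: $\mathcal H$ is a Hilbert space with $\dim\mathcal H=n<\infty$. $A,B$ are self-adjoint operators on $\mathcal H$. $\mathbf z\in\mathcal H$ with $\|\mathbf z\|=1$, $Z=\mathrm{Span}\{\mathbf z\}$, $P$ is the orthogonal projection onto $Z$, $Q=I-P$, and $\kappa\in\mathbb R$, $\kappa\ne0$. A pair $(\alpha,\beta)\in\mathbb C^2$ is a pair-eigenvalue of $M$ if there is a non-zero $(\mathbf u,\mathbf v)\in\mathcal H\oplus\mathcal H$ with $(A-\alpha)\mathbf u+\kappa P\mathbf v=\mathbf 0$ and $\kappa P\mathbf u+(B-\beta)\mathbf v=\mathbf 0$; it is a real pair-eigenvalue if $\alpha,\beta\in\mathbb R$. For a self-adjoint operator $X$, $\Phi_{X,\lambda}$ is the eigenspace for the eigenvalue $\lambda$. For self-adjoint $X:\mathcal H\to\mathcal H$, $X_{\bot,\bot}:=QX|_{Z^\bot}:Z^\bot\to Z^\bot$ and $\Gamma_X:=\{\lambda\in\operatorname{Spec}(X): \exists\,\boldsymbol\varphi\in\Phi_{X,\lambda},\ \boldsymbol\varphi\ne0,\ \langle\mathbf z,\boldsymbol\varphi\rangle=0\}$, $\widetilde\Gamma_X:=\{\lambda\in\operatorname{Spec}(X):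 \langle\mathbf z,\boldsymbol\varphi\rangle=0\ \ \forall\boldsymbol\varphi\in\Phi_{X,\lambda}\}$, $\Delta_X:=\{\lambda\in\operatorname{Spec}(X)\cap\operatorname{Spec}(X_{\bot,\bot}): \dim\Phi_{X_{\bot,\bot},\lambda}>\dim\Phi_{X,\lambda}\}$. For $\alpha\notin\operatorname{Spec}(A)$, $(\alpha,\beta)$ is a pair-eigenvalue if and only if $\beta$ is an eigenvalue of $B-\kappa^2P(A-\alpha)^{-1}P$. The (distinct) curves $(\alpha,\beta(\alpha))$, $\alpha$ real, are formed by real pair-eigenvalues: they are the branches of these eigenvalues as $\alpha$ varies, other than the constant branches $\beta\in\Gamma_B$, extended by continuity to those eigenvalues of $A$ at which the branch has a finite limit; the branch going to $-\infty$ on the left of an eigenvalue of $A$ and the branch coming from $+\infty$ on its right are regarded as one curve. *)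

theory Defs
  imports "HOL-Analysis.Analysis"
begin

(* Finite-dimensional complex Hilbert spaces (completeness is automatic).
   The inner product is linear in its first argument. *)

class fin_dim_hilbert = ab_group_add +
  fixes scaleC :: "complex \<Rightarrow> 'a \<Rightarrow> 'a" (infixr "*\<^sub>C" 75)
    and cinner :: "'a \<Rightarrow> 'a \<Rightarrow> complex"
  assumes scaleC_add_right: "a *\<^sub>C (x + y) = a *\<^sub>C x + a *\<^sub>C y"
    and scaleC_add_left: "(a + b) *\<^sub>C x = a *\<^sub>C x + b *\<^sub>C x"
    and scaleC_scaleC: "a *\<^sub>C b *\<^sub>C x = (a * b) *\<^sub>C x"
    and scaleC_one: "1 *\<^sub>C x = x"
    and cinner_commute: "cinner x y = cnj (cinner y x)"
    and cinner_add_left: "cinner (x + y) w = cinner x w + cinner y w"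
    and cinner_scaleC_left: "cinner (a *\<^sub>C x) y = a * cinner x y"
    and cinner_nonneg: "0 \<le> Re (cinner x x)"
    and cinner_eq_zero_iff: "cinner x x = 0 \<longleftrightarrow> x = 0"
    and finite_spanning_set: "\<exists>F. finite F \<and> (\<forall>v. \<exists>c. v = (\<Sum>u\<in>F. c u *\<^sub>C u))"

global_interpretation cvec: vector_space "scaleC :: complex \<Rightarrow> 'a \<Rightarrow> 'a::fin_dim_hilbert"
  by unfold_locales (simp_all add: scaleC_add_right scaleC_add_left scaleC_scaleC scaleC_one)

definition cnorm :: "'h::fin_dim_hilbert \<Rightarrow> real"
  where "cnorm v = sqrt (Re (cinner v v))"

definition self_adjoint :: "('h::fin_dim_hilbert \<Rightarrow> 'h) \<Rightarrow> bool"
  where "self_adjoint X \<longleftrightarrow> Vector_Spaces.linear scaleC scaleC X \<and>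
    (\<forall>u v. cinner (X u) v = cinner u (X v))"

definition orth_compl :: "'h::fin_dim_hilbert set \<Rightarrow> 'h set"
  where "orth_compl S = {v. \<forall>w\<in>S. cinner v w = 0}"

definition orth_proj :: "'h::fin_dim_hilbert set \<Rightarrow> 'h \<Rightarrow> 'h"
  where "orth_proj S v = (THE w. w \<in> S \<and> v - w \<in> orth_compl S)"

abbreviation Z_line :: "'h::fin_dim_hilbert \<Rightarrow> 'h set"
  where "Z_line z \<equiv> cvec.span {z}"

abbreviation P_proj :: "'h::fin_dim_hilbert \<Rightarrow> 'h \<Rightarrow> 'h"
  where "P_proj z \<equiv> orth_proj (Z_line z)"

abbreviation Q_proj :: "'h::fin_dim_hilbert \<Rightarrow> 'h \<Rightarrow> 'h"
  where "Q_proj z v \<equiv> v - P_proj z v"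

(* Eigenspaces and spectrum of an operator acting on a subspace S; in finite dimension
   the spectrum is the set of eigenvalues.  Operators on the whole space use S = UNIV. *)

definition eigenspace_on :: "'h::fin_dim_hilbert set \<Rightarrow> ('h \<Rightarrow> 'h) \<Rightarrow> complex \<Rightarrow> 'h set"
  where "eigenspace_on S X \<mu> = {\<phi> \<in> S. X \<phi> = \<mu> *\<^sub>C \<phi>}"

definition Spec_on :: "'h::fin_dim_hilbert set \<Rightarrow> ('h \<Rightarrow> 'h) \<Rightarrow> complex set"
  where "Spec_on S X = {\<mu>. \<exists>\<phi> \<in> eigenspace_on S X \<mu>. \<phi> \<noteq> 0}"

abbreviation eigenspace :: "('h::fin_dim_hilbert \<Rightarrow> 'h) \<Rightarrow> complex \<Rightarrow> 'h set"
  where "eigenspace \<equiv> eigenspace_on UNIV"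

abbreviation Spec :: "('h::fin_dim_hilbert \<Rightarrow> 'h) \<Rightarrow> complex set"
  where "Spec \<equiv> Spec_on UNIV"

(* The compression Q X of X, to be read as an operator on the orthogonal complement of z. *)

definition compression :: "'h::fin_dim_hilbert \<Rightarrow> ('h \<Rightarrow> 'h) \<Rightarrow> 'h \<Rightarrow> 'h"
  where "compression z X v = Q_proj z (X v)"

abbreviation eigenspace_perp :: "'h::fin_dim_hilbert \<Rightarrow> ('h \<Rightarrow> 'h) \<Rightarrow> complex \<Rightarrow> 'h set"
  where "eigenspace_perp z X \<equiv> eigenspace_on (orth_compl (Z_line z)) (compression z X)"

abbreviation Spec_perp :: "'h::fin_dim_hilbert \<Rightarrow> ('h \<Rightarrow> 'h) \<Rightarrow> complex set"
  where "Spec_perp z X \<equiv> Spec_on (orth_compl (Z_line z)) (compression z X)"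

definition Gam :: "'h::fin_dim_hilbert \<Rightarrow> ('h \<Rightarrow> 'h) \<Rightarrow> complex set"
  where "Gam z X = {\<mu> \<in> Spec X. \<exists>\<phi> \<in> eigenspace X \<mu>. \<phi> \<noteq> 0 \<and> cinner z \<phi> = 0}"

definition Gam_tilde :: "'h::fin_dim_hilbert \<Rightarrow> ('h \<Rightarrow> 'h) \<Rightarrow> complex set"
  where "Gam_tilde z X = {\<mu> \<in> Spec X. \<forall>\<phi> \<in> eigenspace X \<mu>. cinner z \<phi> = 0}"

definition Delta :: "'h::fin_dim_hilbert \<Rightarrow> ('h \<Rightarrow> 'h) \<Rightarrow> complex set"
  where "Delta z X = {\<mu> \<in> Spec X \<inter> Spec_perp z X.
    cvec.dim (eigenspace_perp z X \<mu>) > cvec.dim (eigenspace X \<mu>)}"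

definition nodes :: "'h::fin_dim_hilbert \<Rightarrow> ('h \<Rightarrow> 'h) \<Rightarrow> complex set"
  where "nodes z X = ((Spec X \<union> Spec_perp z X) - Gam_tilde z X) \<union> Delta z X"

(* x 1 < ... < x m are the (real) points of N, with x 0 and x (m + 1) infinite. *)

definition enumerates :: "(nat \<Rightarrow> ereal) \<Rightarrow> nat \<Rightarrow> complex set \<Rightarrow> bool"
  where "enumerates x m N \<longleftrightarrow>
    strict_mono_on {0..m + 1} x \<and> x 0 = - \<infinity> \<and> x (m + 1) = \<infinity> \<and>
    x ` {1..m} = ereal ` {r. complex_of_real r \<in> N}"

definition rect :: "(nat \<Rightarrow> ereal) \<Rightarrow> (nat \<Rightarrow> ereal) \<Rightarrow> nat \<Rightarrow> nat \<Rightarrow> (real \<times> real) set"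
  where "rect x y p q =
    {(\<alpha>, \<beta>). x (p - 1) < ereal \<alpha> \<and> ereal \<alpha> < x p \<and> y (q - 1) < ereal \<beta> \<and> ereal \<beta> < y q}"

definition pair_eigenvalue ::
    "('h::fin_dim_hilbert \<Rightarrow> 'h) \<Rightarrow> ('h \<Rightarrow> 'h) \<Rightarrow> 'h \<Rightarrow> real \<Rightarrow> complex \<Rightarrow> complex \<Rightarrow> bool"
  where "pair_eigenvalue A B z \<kappa> \<alpha> \<beta> \<longleftrightarrow> (\<exists>u v. (u, v) \<noteq> (0, 0) \<and>
    (A u - \<alpha> *\<^sub>C u) + complex_of_real \<kappa> *\<^sub>C P_proj z v = 0 \<and>
    complex_of_real \<kappa> *\<^sub>C P_proj z u + (B v - \<beta> *\<^sub>C v) = 0)"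

(* The inverse of X - mu; meaningful for mu outside Spec X only. *)

definition resolvent :: "('h::fin_dim_hilbert \<Rightarrow> 'h) \<Rightarrow> complex \<Rightarrow> 'h \<Rightarrow> 'h"
  where "resolvent X \<mu> = inv (\<lambda>v. X v - \<mu> *\<^sub>C v)"

definition reduced_op ::
    "('h::fin_dim_hilbert \<Rightarrow> 'h) \<Rightarrow> ('h \<Rightarrow> 'h) \<Rightarrow> 'h \<Rightarrow> real \<Rightarrow> complex \<Rightarrow> 'h \<Rightarrow> 'h"
  where "reduced_op A B z \<kappa> \<alpha> v =
    B v - complex_of_real (\<kappa>\<^sup>2) *\<^sub>C P_proj z (resolvent A \<alpha> (P_proj z v))"

(* A curve alpha -> beta(alpha) is a partial function on the reals, so that its domain is part
   of the data.  The conditions say in turn: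
   - off Spec A it is everywhere defined and follows the eigenvalues of
     B - kappa^2 P (A - alpha)^(-1) P;
   - it varies continuously, including through the points of Spec A that lie in its domain
     (extension by continuity to the eigenvalues of A with a finite limit);
   - at an eigenvalue of A outside its domain, the branch going to minus infinity on the left is
     joined to the branch coming from plus infinity on the right;
   - it is not one of the constant branches.  This is required on every interval, since
     a non-constant branch may meet a constant one and continuity alone would allow
     switching from one to the other at such a crossing. *)

definition curve ::
    "('h::fin_dim_hilbert \<Rightarrow> 'h) \<Rightarrow> ('h \<Rightarrow> 'h) \<Rightarrow> 'h \<Rightarrow> real \<Rightarrow> (real \<rightharpoonup> real) \<Rightarrow> bool"
  where "curve A B z \<kappa> b \<longleftrightarrow>
    (\<forall>\<alpha>. complex_of_real \<alpha> \<notin> Spec A \<longrightarrow>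
       (\<exists>\<beta>. b \<alpha> = Some \<beta> \<and>
         complex_of_real \<beta> \<in> Spec (reduced_op A B z \<kappa> (complex_of_real \<alpha>)))) \<and>
    continuous_on (dom b) (\<lambda>\<alpha>. the (b \<alpha>)) \<and>
    (\<forall>\<alpha>. \<alpha> \<notin> dom b \<longrightarrow>
       filterlim (\<lambda>a. the (b a)) at_bot (at_left \<alpha>) \<and>
       filterlim (\<lambda>a. the (b a)) at_top (at_right \<alpha>)) \<and>
    \<not> (\<exists>\<beta> l r. complex_of_real \<beta> \<in> Gam z B \<and> l < r \<and> (\<forall>\<alpha>\<in>{l<..<r}. b \<alpha> = Some \<beta>))"

definition curves ::
    "('h::fin_dim_hilbert \<Rightarrow> 'h) \<Rightarrow> ('h \<Rightarrow> 'h) \<Rightarrow> 'h \<Rightarrow> real \<Rightarrow> (real \<rightharpoonup> real) set"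
  where "curves A B z \<kappa> = {b. curve A B z \<kappa> b}"

end

theory Submission
  imports Defs "HOL-Computational_Algebra.Fundamental_Theorem_Algebra"
begin

text \<open>
Let \<open>F\<^sub>X(\<mu>) = \<langle>(X - \<mu>)\<inverse>z, z\<rangle>\<close>. Eliminating \<open>u\<close> and \<open>v\<close> shows that, away from the spectra, \<open>(\<alpha>, \<beta>)\<close> is a
pair-eigenvalue exactly when \<open>\<kappa>\<^sup>2 F\<^sub>A(\<alpha>) F\<^sub>B(\<beta>) = 1\<close>. Writing \<open>z\<close> as a sum of eigenvectors
(\<open>spectral_decomposition\<close>) turns \<open>F\<^sub>X\<close> into a sum of simple poles \<open>\<Sum> w\<^sub>s / (s - \<mu>)\<close> with positive
weights. Its poles are the eigenvalues outside \<open>\<Gamma>~\<^sub>X\<close>, and its poles and zeros together are the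
points \<open>x\<^sub>i\<close> (or \<open>y\<^sub>j\<close>) of the statement (\<open>real_node_iff\<close>); this is where \<open>\<Delta>\<^sub>X\<close> comes from.

Such a function increases between its poles, so it is the tangent of a continuous strictly increasing
angle \<open>\<theta>\<close>, which maps the real line homeomorphically onto \<open>(0, m\<pi>)\<close>, where \<open>m\<close> is the number of
poles. Poles and zeros are the points where \<open>\<theta>\<close> is a multiple of \<open>\<pi>/2\<close>; hence the \<open>i\<close>-th of them has
angle \<open>i\<pi>/2\<close> (\<open>enumerated_angles\<close>). With \<open>tan \<theta>\<^sub>A = \<kappa>\<^sup>2 F\<^sub>A\<close> and \<open>tan \<theta>\<^sub>B = F\<^sub>B\<close> the pair-eigenvalue
equation becomes \<open>cos (\<theta>\<^sub>A(\<alpha>) + \<theta>\<^sub>B(\<beta>)) = 0\<close> (\<open>relation_iff\<close>), which also makes sense at the poles.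

The coordinate \<open>\<theta>\<^sub>B\<close> identifies the \<open>\<beta>\<close>-axis, with \<open>-\<infinity>\<close> and \<open>+\<infinity>\<close> glued, with the circle
\<open>\<real>/m\<pi>\<int>\<close>. A curve cannot stay on a constant branch, and by continuity it cannot switch to one for a while either, so
it always satisfies the cosine equation; on the circle its value moves continuously among the finitely many
solutions for each \<open>\<alpha>\<close>. Hence \<open>\<theta>\<^sub>A(\<alpha>) + \<theta>\<^sub>B(\<beta>(\<alpha>))\<close> is constant modulo \<open>m\<pi>\<close>
(\<open>continuous_selection_follows\<close>, \<open>curve_iff\<close>). The constant \<open>c\<close> is an odd multiple of \<open>\<pi>/2\<close>, and
every such constant gives a curve. All assertions can be read off this normal form:
the sum of the two angles is an odd multiple of \<open>\<pi>/2\<close>, which gives the parity conditions; a curve is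
undefined exactly where \<open>\<theta>\<^sub>A(\<alpha>) \<equiv> c\<close> modulo \<open>m\<pi>\<close>, hence only at poles of \<open>F\<^sub>A\<close>, and at each pole
this determines \<open>c\<close>, hence the curve; since \<open>\<theta>\<^sub>A\<close> and \<open>\<theta>\<^sub>B\<close> increase, \<open>\<beta>(\<alpha>)\<close> decreases; and
differentiating the constant sum gives the formula for \<open>d\<beta>/d\<alpha>\<close>.
\<close>

section \<open>Sums of simple poles and their angle\<close>

definition pole_sum :: "real set \<Rightarrow> (real \<Rightarrow> real) \<Rightarrow> real \<Rightarrow> real"
  where "pole_sum S w x = (\<Sum>s\<in>S. w s / (s - x))"

definition pole_sum_deriv :: "real set \<Rightarrow> (real \<Rightarrow> real) \<Rightarrow> real \<Rightarrow> real"
  where "pole_sum_deriv S w x = (\<Sum>s\<in>S. w s / (s - x)\<^sup>2)"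

lemma pole_sum_scaled:
  "pole_sum S (\<lambda>s. k * w s) x = k * pole_sum S w x"
  "pole_sum_deriv S (\<lambda>s. k * w s) x = k * pole_sum_deriv S w x"
  by (simp_all add: pole_sum_def pole_sum_deriv_def sum_distrib_left)

locale herglotz =
  fixes S :: "real set" and w :: "real \<Rightarrow> real"
  assumes finite_S: "finite S" and nonempty_S: "S \<noteq> {}"
    and w_pos: "\<And>s. s \<in> S \<Longrightarrow> 0 < w s"
begin

abbreviation f :: "real \<Rightarrow> real"
  where "f \<equiv> pole_sum S w"

abbreviation f' :: "real \<Rightarrow> real"
  where "f' \<equiv> pole_sum_deriv S w"

text \<open>
The arctangent of \<open>f\<close> jumps down by \<open>\<pi>\<close> at each pole; counting the poles passed so far repairs the
jump, and \<open>\<pi>/2\<close> is the common one-sided limit at a pole.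
\<close>
definition angle :: "real \<Rightarrow> real"
  where "angle x = pi * real (card {s \<in> S. s < x}) + (if x \<in> S then pi / 2 else arctan (f x))"

definition total :: real
  where "total = real (card S) * pi"

lemma total_pos: "0 < total"
  using finite_S nonempty_S by (simp add: total_def card_gt_0_iff)

lemma f_has_derivative: "x \<notin> S \<Longrightarrow> (f has_real_derivative f' x) (at x)"
  unfolding pole_sum_def[abs_def] pole_sum_deriv_def
  by (rule DERIV_sum) (auto intro!: derivative_eq_intros simp: power2_eq_square)

lemma f'_pos: "x \<notin> S \<Longrightarrow> 0 < f' x"
  unfolding pole_sum_deriv_def
  by (intro sum_pos finite_S nonempty_S divide_pos_pos w_pos) auto

lemma f_split: "s \<in> S \<Longrightarrow> f x = w s / (s - x) + (\<Sum>u\<in>S - {s}. w u / (u - x))"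
  unfolding pole_sum_def using finite_S by (simp add: sum.remove)

lemma f_rest_tendsto:
  assumes "s \<in> S" "F \<le> at s"
  shows "((\<lambda>x. \<Sum>u\<in>S - {s}. w u / (u - x)) \<longlongrightarrow> (\<Sum>u\<in>S - {s}. w u / (u - s))) F"
proof -
  have "((\<lambda>x. \<Sum>u\<in>S - {s}. w u / (u - x)) \<longlongrightarrow> (\<Sum>u\<in>S - {s}. w u / (u - s))) (at s)"
    by (intro tendsto_intros) auto
  then show ?thesis
    using assms(2) by (rule tendsto_mono[rotated])
qed

lemma f_at_left_pole:
  assumes "s \<in> S"
  shows "filterlim f at_top (at_left s)"
proof -
  have "filterlim (\<lambda>x. s - x) (at_right 0) (at_left s)"
    unfolding filterlim_at
    by (auto intro!: tendsto_eq_intros simp: eventually_at_filter)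
  then have "filterlim (\<lambda>x. w s / (s - x)) at_top (at_left s)"
    unfolding divide_inverse
    by (intro filterlim_tendsto_pos_mult_at_top[OF tendsto_const w_pos[OF assms]]
        filterlim_compose[OF filterlim_inverse_at_top_right])
  then have "filterlim (\<lambda>x. (\<Sum>u\<in>S - {s}. w u / (u - x)) + w s / (s - x)) at_top (at_left s)"
    by (rule filterlim_tendsto_add_at_top[OF f_rest_tendsto[OF assms at_le[OF subset_UNIV]]])
  then show ?thesis
    by (simp add: f_split[OF assms, abs_def] add.commute)
qed

lemma f_at_right_pole:
  assumes "s \<in> S"
  shows "filterlim f at_bot (at_right s)"
proof -
  have "filterlim (\<lambda>x. x - s) (at_right 0) (at_right s)"
    unfolding filterlim_at
    by (auto intro!: tendsto_eq_intros simp: eventually_at_filter)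
  then have "filterlim (\<lambda>x. w s / (x - s)) at_top (at_right s)"
    unfolding divide_inverse
    by (intro filterlim_tendsto_pos_mult_at_top[OF tendsto_const w_pos[OF assms]]
        filterlim_compose[OF filterlim_inverse_at_top_right])
  then have "filterlim (\<lambda>x. - (\<Sum>u\<in>S - {s}. w u / (u - x)) + w s / (x - s)) at_top (at_right s)"
    by (rule filterlim_tendsto_add_at_top[OF tendsto_minus[OF f_rest_tendsto[OF assms at_le[OF subset_UNIV]]]])
  moreover have "- (\<Sum>u\<in>S - {s}. w u / (u - x)) + w s / (x - s) = - f x" for x
    using minus_divide_right[of "w s" "s - x"] by (simp add: f_split[OF assms])
  ultimately show ?thesis
    by (simp add: filterlim_uminus_at_bot)
qed

lemma f_at_infinity: "(f \<longlongrightarrow> 0) at_bot" "(f \<longlongrightarrow> 0) at_top"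
proof -
  have "(f \<longlongrightarrow> (\<Sum>s\<in>S. 0)) at_bot"
    unfolding pole_sum_def[abs_def] diff_conv_add_uminus
    by (intro tendsto_sum real_tendsto_divide_at_top[OF tendsto_const]
        filterlim_tendsto_add_at_top[OF tendsto_const] filterlim_uminus_at_top_at_bot)
  then show "(f \<longlongrightarrow> 0) at_bot" by simp
  have "((\<lambda>x. \<Sum>s\<in>S. w s / (- s + x)) \<longlongrightarrow> (\<Sum>s\<in>S. 0)) at_top"
    by (intro tendsto_sum real_tendsto_divide_at_top[OF tendsto_const]
        filterlim_tendsto_add_at_top[OF tendsto_const] filterlim_ident)
  moreover have "(\<Sum>s\<in>S. w s / (- s + x)) = - f x" for x
    unfolding pole_sum_def sum_negf[symmetric] minus_divide_right by simp
  ultimately show "(f \<longlongrightarrow> 0) at_top"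
    using tendsto_minus_cancel_left[of f 0 at_top] by simp
qed

lemma isolated_pole: "\<exists>d>0. \<forall>y. \<bar>y - x\<bar> < d \<and> y \<noteq> x \<longrightarrow> y \<notin> S"
  using finite_set_avoid[OF finite_S, of x] by (fastforce simp: dist_real_def abs_minus_commute)

text \<open>
To the left of a pole \<open>f\<close> tends to \<open>+\<infinity>\<close> and the arctangent to \<open>\<pi>/2\<close>; to the right they tend
to \<open>-\<infinity>\<close> and \<open>-\<pi>/2\<close>, but one more pole is counted, so the one-sided limits agree.
\<close>
lemma angle_isCont: "isCont angle x"
proof -
  obtain d where d: "d > 0" "\<And>y. \<bar>y - x\<bar> < d \<Longrightarrow> y \<noteq> x \<Longrightarrow> y \<notin> S"
    using isolated_pole by blast
  let ?n = "real (card {s \<in> S. s < x})"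
  show ?thesis
  proof (cases "x \<in> S")
    case False
    have "isCont (\<lambda>y. pi * ?n + arctan (f y)) x"
      using DERIV_isCont[OF f_has_derivative[OF False]] by (intro continuous_intros) auto
    moreover have "\<forall>\<^sub>F y in nhds x. angle y = pi * ?n + arctan (f y)"
      unfolding eventually_nhds_metric
    proof (intro exI[of _ d] conjI allI impI d(1))
      fix y assume y: "dist y x < d"
      have noS: "s \<notin> S" if "\<bar>s - x\<bar> < d" for s
        using d(2)[OF that] False by metis
      have "s < y \<longleftrightarrow> s < x" if "s \<in> S" for s
        using noS[of s] that y unfolding dist_real_def by linarith
      then have "{s \<in> S. s < y} = {s \<in> S. s < x}"
        by blast
      then show "angle y = pi * ?n + arctan (f y)"
        using noS y by (simp add: angle_def dist_real_def)
    qed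
    ultimately show ?thesis
      by (simp add: isCont_cong)
  next
    case True
    have "((\<lambda>y. pi * ?n + arctan (f y)) \<longlongrightarrow> pi * ?n + pi / 2) (at_left x)"
      by (intro tendsto_intros filterlim_compose[OF tendsto_arctan_at_top f_at_left_pole[OF True]])
    moreover have "\<forall>\<^sub>F y in at_left x. pi * ?n + arctan (f y) = angle y"
      unfolding eventually_at
    proof (intro exI[of _ d] conjI ballI impI d(1))
      fix y assume y: "y \<in> {..<x}" "y \<noteq> x \<and> dist y x < d"
      have "s < y \<longleftrightarrow> s < x" if "s \<in> S" for s
      proof -
        have "s = x \<or> d \<le> \<bar>s - x\<bar>"
          using d(2)[of s] that by (meson not_le)
        moreover have "y < x" "\<bar>y - x\<bar> < d"
          using y by (auto simp: dist_real_def)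
        ultimately show ?thesis by linarith
      qed
      then have "{s \<in> S. s < y} = {s \<in> S. s < x}"
        by blast
      then show "pi * ?n + arctan (f y) = angle y"
        using d(2) y by (simp add: angle_def dist_real_def)
    qed
    ultimately have left: "(angle \<longlongrightarrow> angle x) (at_left x)"
      using True by (simp add: angle_def Lim_transform_eventually)
    have "((\<lambda>y. pi * (?n + 1) + arctan (f y)) \<longlongrightarrow> pi * (?n + 1) + - (pi / 2)) (at_right x)"
      by (intro tendsto_intros filterlim_compose[OF tendsto_arctan_at_bot f_at_right_pole[OF True]])
    moreover have "\<forall>\<^sub>F y in at_right x. pi * (?n + 1) + arctan (f y) = angle y"
      unfolding eventually_at
    proof (intro exI[of _ d] conjI ballI impI d(1))
      fix y assume y: "y \<in> {x<..}" "y \<noteq> x \<and> dist y x < d"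
      have "s < y \<longleftrightarrow> s < x \<or> s = x" if "s \<in> S" for s
      proof -
        have "s = x \<or> d \<le> \<bar>s - x\<bar>"
          using d(2)[of s] that by (meson not_le)
        moreover have "x < y" "\<bar>y - x\<bar> < d"
          using y by (auto simp: dist_real_def)
        ultimately show ?thesis by linarith
      qed
      then have "{s \<in> S. s < y} = insert x {s \<in> S. s < x}"
        using True by blast
      then have "real (card {s \<in> S. s < y}) = ?n + 1"
        using finite_S by simp
      then show "pi * (?n + 1) + arctan (f y) = angle y"
        using d(2) y by (simp add: angle_def dist_real_def)
    qed
    ultimately have "(angle \<longlongrightarrow> pi * (?n + 1) + - (pi / 2)) (at_right x)"
      by (rule Lim_transform_eventually)
    then have "(angle \<longlongrightarrow> angle x) (at_right x)"
      using True by (simp add: angle_def field_simps)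
    with left show ?thesis
      by (simp add: isCont_def filterlim_at_split)
  qed
qed

lemma angle_has_derivative:
  assumes "x \<notin> S"
  shows "(angle has_real_derivative f' x / (1 + (f x)\<^sup>2)) (at x)"
proof -
  let ?n = "real (card {s \<in> S. s < x})"
  obtain d where d: "d > 0" "\<And>y. \<bar>y - x\<bar> < d \<Longrightarrow> y \<noteq> x \<Longrightarrow> y \<notin> S"
    using isolated_pole by blast
  have "((\<lambda>y. pi * ?n + arctan (f y)) has_real_derivative f' x / (1 + (f x)\<^sup>2)) (at x)"
    using DERIV_add[OF DERIV_const[of "pi * ?n"] DERIV_chain2[OF DERIV_arctan f_has_derivative[OF assms]]]
    by (simp add: divide_inverse mult.commute)
  moreover have "\<forall>\<^sub>F y in nhds x. pi * ?n + arctan (f y) = angle y"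
    unfolding eventually_nhds_metric
  proof (intro exI[of _ d] conjI allI impI d(1))
    fix y assume y: "dist y x < d"
    have noS: "s \<notin> S" if "\<bar>s - x\<bar> < d" for s
      using d(2)[OF that] assms by metis
    have "s < y \<longleftrightarrow> s < x" if "s \<in> S" for s
      using noS[of s] that y unfolding dist_real_def by linarith
    then have "{s \<in> S. s < y} = {s \<in> S. s < x}"
      by blast
    then show "pi * ?n + arctan (f y) = angle y"
      using noS y by (simp add: angle_def dist_real_def)
  qed
  ultimately show ?thesis
    using DERIV_cong_ev[OF refl _ refl] by metis
qed

text \<open>
The derivative is positive off the finitely many poles, so continuity gives monotonicity on each
interval without poles, and the general case follows by cutting at a pole.
\<close>
lemma angle_less: "x < y \<Longrightarrow> angle x < angle y"
proof (induction "card (S \<inter> {x<..<y})" arbitrary: x y rule: less_induct)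
  case less
  show ?case
  proof (cases "S \<inter> {x<..<y} = {}")
    case True
    show ?thesis
    proof (rule DERIV_pos_imp_increasing_open[OF less.prems])
      fix u assume "x < u" "u < y"
      then have "u \<notin> S" using True by auto
      then have "(angle has_real_derivative f' u / (1 + (f u)\<^sup>2)) (at u)"
          "0 < f' u / (1 + (f u)\<^sup>2)"
        using angle_has_derivative[of u] f'_pos[of u] add_pos_nonneg[OF zero_less_one zero_le_power2[of "f u"]]
        by simp_all
      then show "\<exists>d. (angle has_real_derivative d) (at u) \<and> d > 0"
        by (intro exI conjI)
    next
      show "continuous_on {x..y} angle"
        by (simp add: continuous_at_imp_continuous_on angle_isCont)
    qed
  next
    case False
    then obtain s where s: "s \<in> S" "x < s" "s < y" by auto
    have "S \<inter> {x<..<s} \<subset> S \<inter> {x<..<y}" "S \<inter> {s<..<y} \<subset> S \<inter> {x<..<y}"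
      using s by auto
    then have "card (S \<inter> {x<..<s}) < card (S \<inter> {x<..<y})"
        "card (S \<inter> {s<..<y}) < card (S \<inter> {x<..<y})"
      using finite_S by (simp_all add: psubset_card_mono)
    then have "angle x < angle s" "angle s < angle y"
      using less.hyps[of x s] less.hyps[of s y] s by simp_all
    then show ?thesis by simp
  qed
qed

lemma angle_less_iff [simp]: "angle x < angle y \<longleftrightarrow> x < y"
  using angle_less[of x y] angle_less[of y x] by (cases x y rule: linorder_cases) simp_all

lemma angle_eq_iff [simp]: "angle x = angle y \<longleftrightarrow> x = y"
  by (cases x y rule: linorder_cases) (auto dest: angle_less simp del: angle_less_iff)

lemma angle_at_bot: "(angle \<longlongrightarrow> 0) at_bot"
proof -
  have "((\<lambda>x. arctan (f x)) \<longlongrightarrow> 0) at_bot"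
    using tendsto_arctan[OF f_at_infinity(1)] by simp
  moreover have "\<forall>\<^sub>F x in at_bot. arctan (f x) = angle x"
  proof (rule eventually_mono[OF eventually_le_at_bot[of "Min S - 1"]])
    fix x assume "x \<le> Min S - 1"
    then have x: "x < s" if "s \<in> S" for s
      using Min_le[OF finite_S that] by linarith
    then have "{s \<in> S. s < x} = {}" "x \<notin> S"
      by fastforce+
    then show "arctan (f x) = angle x"
      unfolding angle_def by (simp del: Collect_empty_eq)
  qed
  ultimately show ?thesis
    by (rule Lim_transform_eventually)
qed

lemma angle_at_top: "(angle \<longlongrightarrow> total) at_top"
proof -
  have "((\<lambda>x. total + arctan (f x)) \<longlongrightarrow> total + 0) at_top"
    using tendsto_arctan[OF f_at_infinity(2)] by (intro tendsto_intros) simp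
  moreover have "\<forall>\<^sub>F x in at_top. total + arctan (f x) = angle x"
  proof (rule eventually_mono[OF eventually_ge_at_top[of "Max S + 1"]])
    fix x assume "Max S + 1 \<le> x"
    then have x: "s < x" if "s \<in> S" for s
      using Max_ge[OF finite_S that] by linarith
    then have "{s \<in> S. s < x} = S" "x \<notin> S"
      by fastforce+
    then show "total + arctan (f x) = angle x"
      by (simp add: angle_def total_def)
  qed
  ultimately show ?thesis
    using Lim_transform_eventually by fastforce
qed

lemma angle_pos: "0 < angle x"
proof -
  have "0 \<le> angle (x - 1)"
    by (rule tendsto_upperbound[OF angle_at_bot])
      (auto intro: eventually_mono[OF eventually_le_at_bot[of "x - 1"]] simp: less_eq_real_def)
  also have "\<dots> < angle x" by simp
  finally show ?thesis .
qed

lemma angle_less_total: "angle x < total"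
proof -
  have "angle x < angle (x + 1)" by simp
  also have "\<dots> \<le> total"
    by (rule tendsto_lowerbound[OF angle_at_top])
      (auto intro: eventually_mono[OF eventually_ge_at_top[of "x + 1"]] simp: less_eq_real_def)
  finally show ?thesis .
qed

lemma angle_surj:
  assumes "0 < t" "t < total"
  obtains x where "angle x = t"
proof -
  obtain a where a: "angle a < t"
    using order_tendstoD(2)[OF angle_at_bot assms(1)] eventually_happens trivial_limit_at_bot_linorder
    by blast
  obtain b where b: "t < angle b"
    using order_tendstoD(1)[OF angle_at_top assms(2)] eventually_happens trivial_limit_at_top_linorder
    by blast
  have "angle a < angle b"
    using a b by (rule order_less_trans)
  then have "a \<le> b"
    by simp
  then show ?thesis
    using IVT[of angle a t b] a b angle_isCont that by (auto simp: less_imp_le)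
qed

lemma cos_angle_eq_0_iff: "cos (angle x) = 0 \<longleftrightarrow> x \<in> S"
proof (cases "x \<in> S")
  case True
  then show ?thesis
    by (simp add: angle_def cos_add mult.commute)
next
  case False
  then show ?thesis
    using add_pos_nonneg[OF zero_less_one zero_le_power2[of "f x"]]
    by (simp add: angle_def cos_add mult.commute[of pi] cos_arctan)
qed

lemma sin_angle: "x \<notin> S \<Longrightarrow> sin (angle x) = f x * cos (angle x)"
  by (simp add: angle_def cos_add sin_add mult.commute[of pi] cos_arctan sin_arctan)

lemma sin_angle_eq_0_iff: "sin (angle x) = 0 \<longleftrightarrow> x \<notin> S \<and> f x = 0"
proof (cases "x \<in> S")
  case True
  then have "cos (angle x) = 0"
    by (simp add: cos_angle_eq_0_iff)
  then have "sin (angle x) \<noteq> 0"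
    using sin_cos_squared_add[of "angle x"] by auto
  with True show ?thesis by simp
next
  case False
  then show ?thesis
    using cos_angle_eq_0_iff by (simp add: sin_angle)
qed

text \<open>
Inverse of the angle; only its values on \<open>(0, total)\<close> matter.
\<close>
definition unangle :: "real \<Rightarrow> real"
  where "unangle = inv angle"

lemma unangle_angle [simp]: "unangle (angle x) = x"
  unfolding unangle_def by (rule inv_f_f) (auto simp: inj_def)

lemma angle_unangle [simp]: "0 < t \<Longrightarrow> t < total \<Longrightarrow> angle (unangle t) = t"
  by (metis angle_surj unangle_angle)

lemma unangle_isCont:
  assumes "0 < t" "t < total"
  shows "isCont unangle t"
  using isCont_inverse_function[of 1 "unangle t" unangle angle] angle_isCont assms by simp

lemma unangle_has_derivative:
  assumes "x \<notin> S"
  shows "(unangle has_real_derivative inverse (f' x / (1 + (f x)\<^sup>2))) (at (angle x))"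
proof (rule DERIV_inverse_function[where f = angle and a = 0 and b = total])
  show "(angle has_real_derivative f' x / (1 + (f x)\<^sup>2)) (at (unangle (angle x)))"
    using angle_has_derivative[OF assms] by simp
  have "0 < 1 + (f x)\<^sup>2" by (simp add: add_pos_nonneg)
  then show "f' x / (1 + (f x)\<^sup>2) \<noteq> 0"
    using f'_pos[OF assms] by simp
qed (auto simp: angle_pos angle_less_total unangle_isCont)

lemma unangle_less:
  assumes "0 < t" "t < total"
  shows "unangle t < x \<longleftrightarrow> t < angle x" "x < unangle t \<longleftrightarrow> angle x < t"
  using assms angle_less_iff[of "unangle t" x] angle_less_iff[of x "unangle t"] by simp_all

lemma unangle_at_right_0: "filterlim unangle at_bot (at_right 0)"
  unfolding filterlim_at_bot
proof
  fix x
  show "\<forall>\<^sub>F t in at_right 0. unangle t \<le> x"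
    using eventually_at_right_less[of "0::real"] order_tendstoD(2)[OF tendsto_ident_at angle_pos[of x]]
      order_tendstoD(2)[OF tendsto_ident_at total_pos]
    by eventually_elim (simp add: unangle_less less_eq_real_def)
qed

lemma unangle_at_left_total: "filterlim unangle at_top (at_left total)"
  unfolding filterlim_at_top
proof
  fix x
  show "\<forall>\<^sub>F t in at_left total. x \<le> unangle t"
    using eventually_at_left_real[OF total_pos]
      order_tendstoD(1)[OF tendsto_ident_at angle_less_total[of x]]
    by eventually_elim (simp add: unangle_less less_eq_real_def)
qed

end

section \<open>Enumerations of poles and zeros\<close>

text \<open>
The numbers up to \<open>u i\<close> are the images of the numbers up to \<open>i\<close>; compare cardinalities.
\<close>
lemma strict_mono_onto_interval:
  fixes u :: "nat \<Rightarrow> nat"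
  assumes "strict_mono_on {1..m} u" "u ` {1..m} = {1..n}"
  shows "m = n" "i \<in> {1..m} \<Longrightarrow> u i = i"
proof -
  have inj: "inj_on u {1..m}"
    using assms(1) by (rule strict_mono_on_imp_inj_on)
  show "m = n"
    using card_image[OF inj] assms(2) by simp
  assume i: "i \<in> {1..m}"
  have le_iff: "u j \<le> u i \<longleftrightarrow> j \<le> i" if "j \<in> {1..m}" for j
    using strict_mono_on_leD[OF assms(1) that i] strict_mono_onD[OF assms(1) i that]
    by (metis not_le)
  have "u ` {1..i} = {1..u i}"
  proof
    show "u ` {1..i} \<subseteq> {1..u i}"
    proof
      fix k assume "k \<in> u ` {1..i}"
      then obtain j where j: "j \<in> {1..m}" "j \<le> i" "k = u j"
        using i by auto
      then have "k \<in> {1..n}"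
        using assms(2) by blast
      with j le_iff show "k \<in> {1..u i}" by simp
    qed
    show "{1..u i} \<subseteq> u ` {1..i}"
    proof
      fix k assume k: "k \<in> {1..u i}"
      have "u i \<in> {1..n}" using i assms(2) by blast
      with k have "k \<in> u ` {1..m}" using assms(2) by simp
      then obtain j where "j \<in> {1..m}" "k = u j" by blast
      then show "k \<in> u ` {1..i}"
        using le_iff k by auto
    qed
  qed
  moreover have "inj_on u {1..i}"
    using inj_on_subset[OF inj, of "{1..i}"] i by simp
  ultimately show "u i = i"
    using card_image[of u "{1..i}"] by simp
qed

context herglotz
begin

text \<open>
Poles are the zeros of the cosine of the angle and zeros are those of the sine; together they are
the zeros of \<open>sin (2 \<theta>)\<close>.
\<close>
lemma pole_or_zero_iff: "x \<in> S \<or> f x = 0 \<longleftrightarrow> (\<exists>k::int. angle x = of_int k * (pi / 2))"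
proof -
  have "x \<in> S \<or> f x = 0 \<longleftrightarrow> sin (2 * angle x) = 0"
    using cos_angle_eq_0_iff sin_angle_eq_0_iff by (auto simp: sin_double)
  also have "\<dots> \<longleftrightarrow> (\<exists>k::int. angle x = of_int k * (pi / 2))"
    unfolding sin_zero_iff_int2 by (intro ex_cong1) auto
  finally show ?thesis .
qed

text \<open>
The angles of poles and zeros are \<open>\<pi>/2, 2\<pi>/2, \<dots>, (2 card S - 1)\<pi>/2\<close>, each attained once, so in
increasing order the \<open>i\<close>-th point has angle \<open>i\<pi>/2\<close>. With the two infinite end points included, the
position of \<open>\<alpha>\<close> relative to the enumeration is read off its angle.
\<close>
lemma enumerated_angles:
  assumes x: "enumerates x m (complex_of_real ` {r. r \<in> S \<or> f r = 0})"
    and i: "i \<le> m + 1"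
  shows "x i < ereal \<alpha> \<longleftrightarrow> real i * (pi / 2) < angle \<alpha>"
    and "ereal \<alpha> < x i \<longleftrightarrow> angle \<alpha> < real i * (pi / 2)"
proof -
  define n where "n = 2 * card S - 1"
  have n: "real (Suc n) * (pi / 2) = total" "0 < n"
    using finite_S nonempty_S card_gt_0_iff[of S] by (simp_all add: n_def total_def)
  have mono: "strict_mono_on {0..m + 1} x" and ends: "x 0 = - \<infinity>" "x (m + 1) = \<infinity>"
    and range: "x ` {1..m} = ereal ` {r. r \<in> S \<or> f r = 0}"
    using x unfolding enumerates_def by (auto simp: image_iff)
  have "\<exists>r k. x j = ereal r \<and> angle r = real k * (pi / 2) \<and> k \<in> {1..n}" if j: "j \<in> {1..m}" for j
  proof -
    obtain r where r: "x j = ereal r" "r \<in> S \<or> f r = 0"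
      using range j by blast
    then obtain k :: int where k: "angle r = of_int k * (pi / 2)"
      using pole_or_zero_iff by blast
    have "0 < of_int k * (pi / 2)" "of_int k * (pi / 2) < real (Suc n) * (pi / 2)"
      using angle_pos[of r] angle_less_total[of r] n k by simp_all
    then have "0 < (of_int k :: real)" "of_int k < real (Suc n)"
      by (simp_all add: zero_less_mult_iff)
    then have "0 < k" "k < int (Suc n)"
      by linarith+
    then show ?thesis
      using r k by (intro exI[of _ r] exI[of _ "nat k"]) auto
  qed
  then obtain r u where ru: "\<And>j. j \<in> {1..m} \<Longrightarrow> x j = ereal (r j)"
      "\<And>j. j \<in> {1..m} \<Longrightarrow> angle (r j) = real (u j) * (pi / 2)"
      "\<And>j. j \<in> {1..m} \<Longrightarrow> u j \<in> {1..n}"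
    by metis
  have "strict_mono_on {1..m} u"
  proof (rule strict_mono_onI)
    fix j k assume jk: "j \<in> {1..m}" "k \<in> {1..m}" "j < k"
    then have "x j < x k"
      using mono by (auto intro: strict_mono_onD)
    then have "angle (r j) < angle (r k)"
      using jk ru(1) by simp
    then have "real (u j) * (pi / 2) < real (u k) * (pi / 2)"
      unfolding ru(2)[OF jk(1)] ru(2)[OF jk(2)] .
    then show "u j < u k"
      by (simp add: zero_less_mult_iff)
  qed
  moreover have "u ` {1..m} = {1..n}"
  proof
    show "{1..n} \<subseteq> u ` {1..m}"
    proof
      fix k assume k: "k \<in> {1..n}"
      then have "real k * (pi / 2) < real (Suc n) * (pi / 2)"
        by (intro mult_strict_right_mono) auto
      then have "real k * (pi / 2) < total"
        unfolding n(1) .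
      moreover have "0 < real k * (pi / 2)"
        using k by simp
      ultimately obtain q where q: "angle q = real k * (pi / 2)"
        using angle_surj by blast
      then have "q \<in> S \<or> f q = 0"
        unfolding pole_or_zero_iff by (intro exI[of _ "int k"]) simp
      then have "ereal q \<in> x ` {1..m}"
        unfolding range by blast
      then obtain j where j: "j \<in> {1..m}" "ereal q = x j"
        by blast
      then have "r j = q"
        using ru(1)[OF j(1)] by simp
      then have "real (u j) * (pi / 2) = real k * (pi / 2)"
        using ru(2)[OF j(1)] q by metis
      then have "u j = k"
        by simp
      with j show "k \<in> u ` {1..m}" by blast
    qed
  qed (use ru in blast)
  ultimately have "m = n" and u: "\<And>j. j \<in> {1..m} \<Longrightarrow> u j = j"
    using strict_mono_onto_interval by metis+
  have "i = 0 \<or> i \<in> {1..m} \<or> i = m + 1"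
    using i by auto
  then have "(x i < ereal \<alpha> \<longleftrightarrow> real i * (pi / 2) < angle \<alpha>) \<and>
      (ereal \<alpha> < x i \<longleftrightarrow> angle \<alpha> < real i * (pi / 2))"
  proof (elim disjE)
    assume "i \<in> {1..m}"
    then have "x i = ereal (r i)" "real i * (pi / 2) = angle (r i)"
      using ru u by simp_all
    then show ?thesis by simp
  next
    assume "i = m + 1"
    then have "real i * (pi / 2) = total"
      using n \<open>m = n\<close> by simp
    then show ?thesis
      using ends \<open>i = m + 1\<close> angle_less_total[of \<alpha>] by (simp del: of_nat_add)
  qed (use ends angle_pos[of \<alpha>] in \<open>auto simp: not_less less_imp_le\<close>)
  then show "x i < ereal \<alpha> \<longleftrightarrow> real i * (pi / 2) < angle \<alpha>"
    and "ereal \<alpha> < x i \<longleftrightarrow> angle \<alpha> < real i * (pi / 2)"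
    by blast+
qed

text \<open>
The relevant index is the least one whose point is not below \<open>\<alpha>\<close>.
\<close>
lemma enumerated_position:
  assumes x: "enumerates x m (complex_of_real ` {r. r \<in> S \<or> f r = 0})"
  obtains p where "p \<in> {1..m + 1}" "x (p - 1) < ereal \<alpha>" "ereal \<alpha> < x p"
  | i where "i \<in> {1..m}" "ereal \<alpha> = x i"
proof -
  have "x 0 = - \<infinity>" "x (m + 1) = \<infinity>"
    using x by (simp_all add: enumerates_def)
  then have ends: "\<not> ereal \<alpha> \<le> x 0" "ereal \<alpha> \<le> x (m + 1)" "ereal \<alpha> \<noteq> x (m + 1)"
    by simp_all
  define p where "p = (LEAST i. ereal \<alpha> \<le> x i)"
  have p: "ereal \<alpha> \<le> x p" "p \<le> m + 1"
    unfolding p_def using ends(2) by (auto intro: LeastI Least_le)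
  have "p \<noteq> 0"
    using p(1) ends(1) by metis
  then have below: "x (p - 1) < ereal \<alpha>"
    using not_less_Least[of "p - 1" "\<lambda>i. ereal \<alpha> \<le> x i"] by (simp add: p_def[symmetric] not_le)
  show ?thesis
  proof (cases "ereal \<alpha> = x p")
    case True
    then have "p \<noteq> m + 1"
      using ends(3) by metis
    with True p(2) \<open>p \<noteq> 0\<close> show ?thesis
      by (intro that(2)[of p]) auto
  next
    case False
    with p below \<open>p \<noteq> 0\<close> show ?thesis
      by (intro that(1)[of p]) auto
  qed
qed

end

section \<open>Curves along which two angles have constant sum\<close>

lemma int_multiple_small:
  assumes "\<bar>of_int n * T\<bar> < (T :: real)"
  shows "n = 0"
proof (rule ccontr)
  assume "n \<noteq> 0"
  then have "1 \<le> \<bar>real_of_int n\<bar>" by linarith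
  moreover have "0 < T" using assms by linarith
  ultimately have "T \<le> \<bar>real_of_int n\<bar> * T" by simp
  then show False using assms \<open>0 < T\<close> by (simp add: abs_mult)
qed

locale herglotz_pair = left: herglotz S w + right: herglotz T v for S w T v
begin

text \<open>
When neither point is a pole, dividing by the two cosines turns the condition into
\<open>tan \<theta>\<^sub>l tan \<theta>\<^sub>r = 1\<close>. At a pole the cosine vanishes and the sine does not, so the sum of the angles
is an odd multiple of \<open>\<pi>/2\<close> only if the other sine vanishes, that is, only at a zero of the
other function.
\<close>
lemma cos_angle_sum_iff:
  "cos (left.angle \<alpha> + right.angle \<beta>) = 0 \<longleftrightarrow>
    (\<alpha> \<in> S \<and> \<beta> \<notin> T \<and> right.f \<beta> = 0) \<or> (\<alpha> \<notin> S \<and> left.f \<alpha> = 0 \<and> \<beta> \<in> T) \<or>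
    (\<alpha> \<notin> S \<and> \<beta> \<notin> T \<and> left.f \<alpha> * right.f \<beta> = 1)"
proof -
  note [simp] = left.cos_angle_eq_0_iff right.cos_angle_eq_0_iff
    left.sin_angle_eq_0_iff right.sin_angle_eq_0_iff
  show ?thesis
  proof (cases "\<alpha> \<in> S \<or> \<beta> \<in> T")
    case True
    then have "cos (left.angle \<alpha>) * cos (right.angle \<beta>) = 0"
      by auto
    then have "cos (left.angle \<alpha> + right.angle \<beta>) = - (sin (left.angle \<alpha>) * sin (right.angle \<beta>))"
      by (simp add: cos_add)
    with True show ?thesis
      by auto
  next
    case False
    then have "cos (left.angle \<alpha> + right.angle \<beta>) =
        cos (left.angle \<alpha>) * cos (right.angle \<beta>) * (1 - left.f \<alpha> * right.f \<beta>)"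
      using left.sin_angle[of \<alpha>] right.sin_angle[of \<beta>] by (simp add: cos_add algebra_simps)
    with False show ?thesis
      by auto
  qed
qed

text \<open>
The partial function is a lift through the right-hand angle: at every point where it is defined the
sum of the angles is \<open>c\<close> modulo the length \<open>total\<close> of the range of the right-hand angle, and it is
defined wherever such a value exists.
\<close>
definition follows :: "(real \<rightharpoonup> real) \<Rightarrow> real \<Rightarrow> bool"
  where "follows b c \<longleftrightarrow> (\<forall>\<alpha> \<beta>. b \<alpha> = Some \<beta> \<longleftrightarrow>
    (\<exists>n. left.angle \<alpha> + right.angle \<beta> = c + of_int n * right.total))"

text \<open>
The right-hand angle takes values in an open interval of length \<open>total\<close>, so its value modulo
\<open>total\<close> determines the point.
\<close>
lemma right_angle_unique:
  assumes "left.angle \<alpha> + right.angle \<beta> = c + of_int n * right.total"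
    "left.angle \<alpha> + right.angle \<beta>' = c + of_int k * right.total"
  shows "\<beta> = \<beta>'"
proof -
  have eq: "of_int (n - k) * right.total = right.angle \<beta> - right.angle \<beta>'"
    unfolding of_int_diff left_diff_distrib using assms by linarith
  then have "\<bar>of_int (n - k) * right.total\<bar> < right.total"
    using right.angle_pos[of \<beta>] right.angle_pos[of \<beta>'] right.angle_less_total[of \<beta>]
      right.angle_less_total[of \<beta>'] by linarith
  then have "n - k = 0" by (rule int_multiple_small)
  with eq show ?thesis by simp
qed

text \<open>
The class of \<open>0\<close> modulo \<open>total\<close> is the only one that the right-hand angle omits; it stands for the
point at infinity.
\<close>
lemma right_angle_not_multiple:
  assumes "left.angle \<alpha> + right.angle \<beta> = c + of_int n * right.total"
  shows "left.angle \<alpha> \<noteq> c + of_int k * right.total"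
proof
  assume "left.angle \<alpha> = c + of_int k * right.total"
  then have eq: "of_int (n - k) * right.total = right.angle \<beta>"
    unfolding of_int_diff left_diff_distrib using assms by linarith
  then have "\<bar>of_int (n - k) * right.total\<bar> < right.total"
    using right.angle_pos[of \<beta>] right.angle_less_total[of \<beta>] by linarith
  then have "n - k = 0" by (rule int_multiple_small)
  with eq show False
    using right.angle_pos[of \<beta>] by simp
qed

text \<open>
At most one value is possible by \<open>right_angle_unique\<close>, so the relation itself defines the function.
\<close>
lemma follows_exists: "\<exists>b. follows b c"
proof -
  let ?R = "\<lambda>\<alpha> \<beta>. \<exists>n. left.angle \<alpha> + right.angle \<beta> = c + of_int n * right.total"
  have unique: "\<beta> = \<beta>'" if "?R \<alpha> \<beta>" "?R \<alpha> \<beta>'" for \<alpha> \<beta> \<beta>'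
    using that right_angle_unique by blast
  define b where "b \<alpha> = (if \<exists>\<beta>. ?R \<alpha> \<beta> then Some (SOME \<beta>. ?R \<alpha> \<beta>) else None)" for \<alpha>
  have "b \<alpha> = Some \<beta> \<longleftrightarrow> ?R \<alpha> \<beta>" for \<alpha> \<beta>
  proof
    assume "b \<alpha> = Some \<beta>"
    then have "\<exists>\<beta>. ?R \<alpha> \<beta>" "\<beta> = (SOME \<beta>. ?R \<alpha> \<beta>)"
      by (auto simp: b_def split: if_splits)
    then show "?R \<alpha> \<beta>"
      using someI_ex[of "?R \<alpha>"] by simp
  next
    assume R: "?R \<alpha> \<beta>"
    then have "?R \<alpha> (SOME \<beta>. ?R \<alpha> \<beta>)"
      by (rule someI)
    with R have "(SOME \<beta>. ?R \<alpha> \<beta>) = \<beta>"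
      by (intro unique)
    with R show "b \<alpha> = Some \<beta>"
      unfolding b_def by auto
  qed
  then show ?thesis
    unfolding follows_def by blast
qed

lemma follows_unique:
  assumes "follows b c" "follows b' c'" "c' = c + of_int n * right.total"
  shows "b = b'"
proof -
  have "(\<exists>k. left.angle \<alpha> + right.angle \<beta> = c + of_int k * right.total) \<longleftrightarrow>
      (\<exists>k. left.angle \<alpha> + right.angle \<beta> = c' + of_int k * right.total)" for \<alpha> \<beta>
  proof (intro iffI; elim exE)
    fix k assume "left.angle \<alpha> + right.angle \<beta> = c + of_int k * right.total"
    then show "\<exists>k. left.angle \<alpha> + right.angle \<beta> = c' + of_int k * right.total"
      using assms(3) by (intro exI[of _ "k - n"]) (simp add: algebra_simps)
  next
    fix k assume "left.angle \<alpha> + right.angle \<beta> = c' + of_int k * right.total"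
    then show "\<exists>k. left.angle \<alpha> + right.angle \<beta> = c + of_int k * right.total"
      using assms(3) by (intro exI[of _ "k + n"]) (simp add: algebra_simps)
  qed
  then have "b \<alpha> = Some \<beta> \<longleftrightarrow> b' \<alpha> = Some \<beta>" for \<alpha> \<beta>
    using assms(1,2) unfolding follows_def by simp
  then show ?thesis
    by (intro ext) (metis option.exhaust)
qed

context
  fixes b c
  assumes follows: "follows b c"
begin

lemma follows_eqI:
  assumes "left.angle \<alpha> + t = c + of_int n * right.total" "0 < t" "t < right.total"
  shows "b \<alpha> = Some (right.unangle t)"
  using follows assms unfolding follows_def by auto

text \<open>
Reduce the required angle \<open>c - left.angle \<alpha>\<close> to \<open>[0, total)\<close>: a positive remainder is the angle of a
value, and the remainder \<open>0\<close> stands for infinity.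
\<close>
lemma follows_None_iff: "\<alpha> \<notin> dom b \<longleftrightarrow> (\<exists>n. left.angle \<alpha> = c + of_int n * right.total)"
proof
  assume out: "\<alpha> \<notin> dom b"
  define n where "n = \<lfloor>(c - left.angle \<alpha>) / right.total\<rfloor>"
  have "of_int n \<le> (c - left.angle \<alpha>) / right.total" "(c - left.angle \<alpha>) / right.total < of_int n + 1"
    unfolding n_def by linarith+
  then have "of_int n * right.total \<le> c - left.angle \<alpha>"
      "c - left.angle \<alpha> < of_int n * right.total + right.total"
    using right.total_pos by (simp_all add: field_simps)
  then have "c - left.angle \<alpha> - of_int n * right.total = 0"
    using follows_eqI[of \<alpha> "c - left.angle \<alpha> - of_int n * right.total" "- n"] out by fastforce
  then show "\<exists>n. left.angle \<alpha> = c + of_int n * right.total"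
    by (intro exI[of _ "- n"]) simp
next
  assume "\<exists>n. left.angle \<alpha> = c + of_int n * right.total"
  then obtain n where n: "left.angle \<alpha> = c + of_int n * right.total" ..
  show "\<alpha> \<notin> dom b"
  proof
    assume "\<alpha> \<in> dom b"
    then obtain \<beta> k where "left.angle \<alpha> + right.angle \<beta> = c + of_int k * right.total"
      using follows unfolding follows_def by blast
    with n show False
      using right_angle_not_multiple by blast
  qed
qed

text \<open>
The sum of the angles is constant near a point of the domain and not only constant modulo \<open>total\<close>.
This explicit local form yields continuity and the derivative.
\<close>
lemma follows_locally:
  assumes "b \<alpha> = Some \<beta>"
  shows "\<forall>\<^sub>F a in nhds \<alpha>. b a = Some (right.unangle (left.angle \<alpha> + right.angle \<beta> - left.angle a))"
proof -
  obtain n where n: "left.angle \<alpha> + right.angle \<beta> = c + of_int n * right.total"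
    using follows assms unfolding follows_def by blast
  let ?t = "\<lambda>a. left.angle \<alpha> + right.angle \<beta> - left.angle a"
  have "(?t \<longlongrightarrow> ?t \<alpha>) (nhds \<alpha>)"
    using left.angle_isCont[of \<alpha>] by (intro tendsto_intros) (simp add: isCont_def tendsto_at_iff_tendsto_nhds)
  then have "\<forall>\<^sub>F a in nhds \<alpha>. 0 < ?t a" "\<forall>\<^sub>F a in nhds \<alpha>. ?t a < right.total"
    using order_tendstoD[where f = ?t] right.angle_pos[of \<beta>] right.angle_less_total[of \<beta>]
    by (auto simp del: diff_gt_0_iff_gt)
  then show ?thesis
    by eventually_elim (rule follows_eqI, simp_all add: n)
qed

lemma follows_isCont:
  assumes "\<alpha> \<in> dom b"
  shows "isCont (\<lambda>a. the (b a)) \<alpha>"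
proof -
  obtain \<beta> where \<beta>: "b \<alpha> = Some \<beta>" using assms by blast
  have "isCont (\<lambda>a. right.unangle (left.angle \<alpha> + right.angle \<beta> - left.angle a)) \<alpha>"
  proof (rule isCont_o2[where g = right.unangle])
    show "isCont (\<lambda>a. left.angle \<alpha> + right.angle \<beta> - left.angle a) \<alpha>"
      using left.angle_isCont[of \<alpha>] by (intro continuous_intros)
  qed (simp add: right.unangle_isCont right.angle_pos right.angle_less_total)
  moreover have "\<forall>\<^sub>F a in nhds \<alpha>. the (b a) = right.unangle (left.angle \<alpha> + right.angle \<beta> - left.angle a)"
    using follows_locally[OF \<beta>] by eventually_elim simp
  ultimately show ?thesis
    by (simp add: isCont_cong)
qed

lemma follows_has_derivative:
  assumes "b \<alpha> = Some \<beta>" "\<alpha> \<notin> S" "\<beta> \<notin> T"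
  shows "((\<lambda>a. the (b a)) has_real_derivative
    inverse (right.f' \<beta> / (1 + (right.f \<beta>)\<^sup>2)) * - (left.f' \<alpha> / (1 + (left.f \<alpha>)\<^sup>2))) (at \<alpha>)"
proof -
  let ?t = "\<lambda>a. left.angle \<alpha> + right.angle \<beta> - left.angle a"
  have "(?t has_real_derivative - (left.f' \<alpha> / (1 + (left.f \<alpha>)\<^sup>2))) (at \<alpha>)"
    using DERIV_diff[OF DERIV_const left.angle_has_derivative[OF assms(2)]] by simp
  moreover have "(right.unangle has_real_derivative inverse (right.f' \<beta> / (1 + (right.f \<beta>)\<^sup>2))) (at (?t \<alpha>))"
    using right.unangle_has_derivative[OF assms(3)] by simp
  ultimately have D: "((\<lambda>a. right.unangle (?t a)) has_real_derivative
      inverse (right.f' \<beta> / (1 + (right.f \<beta>)\<^sup>2)) * - (left.f' \<alpha> / (1 + (left.f \<alpha>)\<^sup>2))) (at \<alpha>)"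
    by (rule DERIV_chain2[rotated])
  have ev: "\<forall>\<^sub>F a in nhds \<alpha>. the (b a) = right.unangle (?t a)"
    using follows_locally[OF assms(1)] by eventually_elim simp
  show ?thesis
    unfolding DERIV_cong_ev[OF refl ev refl] by (rule D)
qed

text \<open>
Approaching the point from the left, the right-hand angle of the value is
\<open>left.angle \<alpha> - left.angle a\<close>, which decreases to \<open>0\<close>; past the point it
reappears at the other end \<open>total\<close> of the range.
\<close>
lemma follows_blowup:
  assumes "\<alpha> \<notin> dom b"
  shows "filterlim (\<lambda>a. the (b a)) at_bot (at_left \<alpha>)" "filterlim (\<lambda>a. the (b a)) at_top (at_right \<alpha>)"
proof -
  obtain n where n: "left.angle \<alpha> = c + of_int n * right.total"
    using assms unfolding follows_None_iff by blast
  have lim: "((\<lambda>a. left.angle \<alpha> - left.angle a) \<longlongrightarrow> 0) (at \<alpha>)"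
    using left.angle_isCont[of \<alpha>] by (auto intro!: tendsto_eq_intros simp: isCont_def)
  have l: "\<forall>\<^sub>F a in at_left \<alpha>. 0 < left.angle \<alpha> - left.angle a"
    "\<forall>\<^sub>F a in at_right \<alpha>. left.angle \<alpha> - left.angle a < 0"
    by (simp_all add: eventually_at_filter)
  have lim_l: "((\<lambda>a. left.angle \<alpha> - left.angle a) \<longlongrightarrow> 0) (at_left \<alpha>)"
    and lim_r: "((\<lambda>a. left.angle \<alpha> - left.angle a) \<longlongrightarrow> 0) (at_right \<alpha>)"
    using lim by (simp_all add: filterlim_at_split)
  have "filterlim (\<lambda>a. left.angle \<alpha> - left.angle a) (at_right 0) (at_left \<alpha>)"
    unfolding filterlim_at using lim_l l(1) by (auto elim: eventually_mono)
  then have "filterlim (\<lambda>a. right.unangle (left.angle \<alpha> - left.angle a)) at_bot (at_left \<alpha>)"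
    by (rule filterlim_compose[OF right.unangle_at_right_0])
  moreover have "\<forall>\<^sub>F a in at_left \<alpha>. right.unangle (left.angle \<alpha> - left.angle a) = the (b a)"
    using l(1) order_tendstoD(2)[OF lim_l right.total_pos]
    by eventually_elim (subst follows_eqI[where n = n], simp_all add: n)
  ultimately show "filterlim (\<lambda>a. the (b a)) at_bot (at_left \<alpha>)"
    by (simp add: filterlim_cong)
  let ?t = "\<lambda>a. right.total + (left.angle \<alpha> - left.angle a)"
  have "(?t \<longlongrightarrow> right.total) (at_right \<alpha>)"
    using tendsto_add[OF tendsto_const lim_r, of right.total] by simp
  then have "filterlim ?t (at_left right.total) (at_right \<alpha>)"
    unfolding filterlim_at using l(2) by (auto elim: eventually_mono)
  then have "filterlim (\<lambda>a. right.unangle (?t a)) at_top (at_right \<alpha>)"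
    by (rule filterlim_compose[OF right.unangle_at_left_total])
  moreover have "- right.total < 0" using right.total_pos by simp
  have "\<forall>\<^sub>F a in at_right \<alpha>. right.unangle (?t a) = the (b a)"
    using l(2) order_tendstoD(1)[OF lim_r \<open>- right.total < 0\<close>]
    by eventually_elim (subst follows_eqI[where n = "n + 1"], simp_all add: n algebra_simps)
  ultimately show "filterlim (\<lambda>a. the (b a)) at_top (at_right \<alpha>)"
    by (simp add: filterlim_cong)
qed

text \<open>
If the sum of the angles does not grow, the claim follows since both angles increase. If the
multiple of \<open>total\<close> went up between the end points, the left-hand angle would cross \<open>c\<close> modulo
\<open>total\<close> in between, where the function is undefined.
\<close>
lemma follows_decreasing:
  assumes "l < r" "{l..r} \<subseteq> dom b"
  shows "the (b r) < the (b l)"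
proof -
  obtain \<beta>l \<beta>r where \<beta>: "b l = Some \<beta>l" "b r = Some \<beta>r"
    using assms by (metis atLeastAtMost_iff domD less_imp_le order_refl subsetD)
  then obtain n k where n: "left.angle l + right.angle \<beta>l = c + of_int n * right.total"
    and k: "left.angle r + right.angle \<beta>r = c + of_int k * right.total"
    using follows unfolding follows_def by blast
  have "k \<le> n"
  proof (rule ccontr)
    assume "\<not> k \<le> n"
    then have "of_int n + 1 \<le> (of_int k :: real)" by linarith
    then have "(of_int n + 1) * right.total \<le> of_int k * right.total"
      using right.total_pos by simp
    then have "left.angle l \<le> c + of_int n * right.total" "c + of_int n * right.total \<le> left.angle r"
      using n k right.angle_pos[of \<beta>l] right.angle_less_total[of \<beta>r] by (simp_all add: algebra_simps)
    then obtain a where "l \<le> a" "a \<le> r" "left.angle a = c + of_int n * right.total"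
      using IVT[of left.angle l "c + of_int n * right.total" r] assms(1) left.angle_isCont by auto
    then show False
      using follows_None_iff assms(2) by (metis atLeastAtMost_iff subsetD)
  qed
  then have "of_int k * right.total \<le> of_int n * right.total"
    using right.total_pos by simp
  then have "right.angle \<beta>r < right.angle \<beta>l"
    using n k left.angle_less[OF assms(1)] by linarith
  with \<beta> show ?thesis by simp
qed

lemma follows_not_constant: "\<not> (\<exists>\<beta> l r. l < r \<and> (\<forall>\<alpha>\<in>{l<..<r}. b \<alpha> = Some \<beta>))"
proof (intro notI, elim exE conjE)
  fix \<beta> l r :: real assume lr: "l < r" "\<forall>\<alpha>\<in>{l<..<r}. b \<alpha> = Some \<beta>"
  obtain l' r' where "l < l'" "l' < r'" "r' < r"
    using dense[OF lr(1)] dense by metis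
  then show False
    using follows_decreasing[of l' r'] lr(2) by (force simp: dom_def)
qed

end

text \<open>
Every continuous selection is a lift. The finite set \<open>G\<close> contains the values on the constant
branches, and \<open>E\<close> the points where no selection is required. On the open set where
the selection leaves the cosine relation it takes finitely many values, hence is locally constant
with value in \<open>G\<close>, which is excluded. The sum of the angles, wrapped around a circle of circumference
\<open>right.total\<close> so that the two infinite limits of the selection agree, is then a continuous map on the
line with finitely many values, hence constant.
\<close>
theorem continuous_selection_follows:
  assumes "finite E" "finite G"
    and selects: "\<And>\<alpha>. \<alpha> \<notin> E \<Longrightarrow> \<exists>\<beta>. b \<alpha> = Some \<beta> \<and> (\<beta> \<in> G \<or> cos (left.angle \<alpha> + right.angle \<beta>) = 0)"
    and continuous: "continuous_on (dom b) (\<lambda>\<alpha>. the (b \<alpha>))"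
    and blowup: "\<And>\<alpha>. \<alpha> \<notin> dom b \<Longrightarrow> filterlim (\<lambda>a. the (b a)) at_bot (at_left \<alpha>)"
      "\<And>\<alpha>. \<alpha> \<notin> dom b \<Longrightarrow> filterlim (\<lambda>a. the (b a)) at_top (at_right \<alpha>)"
    and not_constant: "\<not> (\<exists>\<beta> l r. \<beta> \<in> G \<and> l < r \<and> (\<forall>\<alpha>\<in>{l<..<r}. b \<alpha> = Some \<beta>))"
  shows "\<exists>c. cos c = 0 \<and> follows b c"
proof -
  let ?b = "\<lambda>a. the (b a)"
  have dom: "- dom b \<subseteq> E"
    using selects by blast
  have open_dom: "open (dom b)"
    using finite_imp_closed[OF finite_subset[OF dom assms(1)]] by (simp add: open_closed)
  have cont: "isCont ?b \<alpha>" if "\<alpha> \<in> dom b" for \<alpha>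
    using continuous that open_dom by (simp add: continuous_on_eq_continuous_at)
  let ?phase = "\<lambda>a. left.angle a + right.angle (?b a)"
  have cont_phase: "isCont ?phase \<alpha>" if "\<alpha> \<in> dom b" for \<alpha>
    by (rule isCont_add[OF left.angle_isCont isCont_o2[OF cont[OF that] right.angle_isCont]])
  have relation: "cos (?phase \<alpha>) = 0" if \<alpha>: "\<alpha> \<in> dom b" for \<alpha>
  proof (rule ccontr)
    assume "cos (?phase \<alpha>) \<noteq> 0"
    have "isCont (\<lambda>a. cos (?phase a)) \<alpha>"
      by (rule isCont_o2[OF cont_phase[OF \<alpha>] isCont_cos])
    then have "((\<lambda>a. cos (?phase a)) \<longlongrightarrow> cos (?phase \<alpha>)) (nhds \<alpha>)"
      using tendsto_at_iff_tendsto_nhds[of "\<lambda>a. cos (?phase a)" \<alpha>] by (simp add: isCont_def)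
    then have "\<forall>\<^sub>F a in nhds \<alpha>. cos (?phase a) \<noteq> 0"
      using \<open>cos (?phase \<alpha>) \<noteq> 0\<close> by (rule tendsto_imp_eventually_ne)
    moreover have "\<forall>\<^sub>F a in nhds \<alpha>. a \<in> dom b"
      using open_dom \<alpha> by (rule eventually_nhds_in_open)
    ultimately have "\<forall>\<^sub>F a in nhds \<alpha>. a \<in> dom b \<and> cos (?phase a) \<noteq> 0"
      by eventually_elim simp
    then obtain d where d: "d > 0" "\<And>a. \<bar>a - \<alpha>\<bar> < d \<Longrightarrow> a \<in> dom b \<and> cos (?phase a) \<noteq> 0"
      unfolding eventually_nhds_metric dist_real_def by blast
    let ?I = "{\<alpha> - d<..<\<alpha> + d}"
    have I: "a \<in> dom b" "cos (?phase a) \<noteq> 0" if "a \<in> ?I" for a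
      using d(2)[of a] that by (auto simp: abs_less_iff)
    have in_G: "?b a \<in> G" if "a \<in> ?I" "a \<notin> E" for a
      using selects[OF that(2)] I(2)[OF that(1)] by auto
    have "?b ` ?I \<subseteq> G \<union> ?b ` E"
      using in_G by blast
    then have "finite (?b ` ?I)"
      using assms(1,2) by (meson finite_UnI finite_imageI finite_subset)
    moreover have "connected (?b ` ?I)"
      using cont I(1) by (intro connected_continuous_image continuous_at_imp_continuous_on) auto
    ultimately obtain \<beta> where \<beta>: "?b ` ?I \<subseteq> {\<beta>}"
      by (metis connected_finite_iff_sing empty_subsetI order_refl)
    have "infinite (?I - E)"
      using d(1) assms(1) by (simp add: infinite_Ioo)
    then obtain a where "a \<in> ?I" "a \<notin> E"
      by (metis Diff_iff finite.emptyI ex_in_conv)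
    then have "\<beta> \<in> G"
      using in_G \<beta> by blast
    moreover have "\<alpha> - d < \<alpha> + d"
      using d(1) by simp
    moreover have "\<forall>a\<in>?I. b a = Some \<beta>"
      using \<beta> I(1) by fastforce
    ultimately show False
      using not_constant by blast
  qed
  \<comment> \<open>Off the domain the right-hand angle counts as \<open>0\<close>, which is the same as \<open>right.total\<close> on the circle.\<close>
  define g where "g a = (if a \<in> dom b then cis (2 * pi / right.total * ?phase a)
    else cis (2 * pi / right.total * left.angle a))" for a
  have g_limit: "(g \<longlongrightarrow> cis (2 * pi / right.total * (left.angle \<alpha> + e))) F"
    if "\<alpha> \<notin> dom b" "F \<le> at \<alpha>" "((\<lambda>a. right.angle (?b a)) \<longlongrightarrow> e) F" for \<alpha> F e
  proof -
    have "\<forall>\<^sub>F a in at \<alpha>. a \<notin> E"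
      using islimpt_finite[OF assms(1)] islimpt_iff_eventually by blast
    then have "\<forall>\<^sub>F a in at \<alpha>. a \<in> dom b"
      by eventually_elim (use dom in blast)
    with that(2) have "\<forall>\<^sub>F a in F. a \<in> dom b"
      by (rule filter_leD)
    then have "\<forall>\<^sub>F a in F. cis (2 * pi / right.total * ?phase a) = g a"
      by eventually_elim (simp add: g_def)
    moreover have "(left.angle \<longlongrightarrow> left.angle \<alpha>) F"
      using left.angle_isCont[of \<alpha>] that(2) by (meson isContD tendsto_mono)
    then have "((\<lambda>a. cis (2 * pi / right.total * ?phase a)) \<longlongrightarrow>
        cis (2 * pi / right.total * (left.angle \<alpha> + e))) F"
      using that(3) by (intro tendsto_intros)
    ultimately show ?thesis
      using Lim_transform_eventually by blast
  qed
  have cont_g: "isCont g \<alpha>" for \<alpha>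
  proof (cases "\<alpha> \<in> dom b")
    case True
    have "isCont (\<lambda>a. cis (2 * pi / right.total * ?phase a)) \<alpha>"
      by (rule isCont_o2[OF cont_phase[OF True]]) (unfold isCont_def, intro tendsto_intros)
    moreover have "\<forall>\<^sub>F a in nhds \<alpha>. g a = cis (2 * pi / right.total * ?phase a)"
      using eventually_nhds_in_open[OF open_dom True] by eventually_elim (simp add: g_def)
    ultimately show ?thesis
      by (simp add: isCont_cong)
  next
    case False
    have "((\<lambda>a. right.angle (?b a)) \<longlongrightarrow> 0) (at_left \<alpha>)"
      using filterlim_compose[OF right.angle_at_bot blowup(1)[OF False]] .
    then have "(g \<longlongrightarrow> g \<alpha>) (at_left \<alpha>)"
      using g_limit[OF False, of "at_left \<alpha>" 0] False by (simp add: g_def at_le)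
    moreover have "((\<lambda>a. right.angle (?b a)) \<longlongrightarrow> right.total) (at_right \<alpha>)"
      using filterlim_compose[OF right.angle_at_top blowup(2)[OF False]] .
    then have "(g \<longlongrightarrow> cis (2 * pi / right.total * (left.angle \<alpha> + right.total))) (at_right \<alpha>)"
      using g_limit[OF False, of "at_right \<alpha>"] by (simp add: at_le)
    moreover have "cis (2 * pi / right.total * (left.angle \<alpha> + right.total)) = g \<alpha>"
      using right.total_pos False by (simp add: g_def distrib_left cis_mult[symmetric])
    ultimately show ?thesis
      by (simp add: isCont_def filterlim_at_split)
  qed
  have total: "right.total = real (card T) * pi"
    by (rule right.total_def)
  have cardT: "card T \<noteq> 0"
    using right.finite_S right.nonempty_S by simp
  \<comment> \<open>The factor \<open>2 \<pi> / right.total\<close> is \<open>2 / card T\<close>, so this power is the exponential of twice the phase.\<close>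
  have g_root: "g a ^ card T = -1" if a: "a \<in> dom b" for a
  proof -
    have cis: "cis (2 * ?phase a) = -1"
      unfolding complex_eq_iff cis.sel cos_double_cos sin_double relation[OF a] by simp
    have "g a ^ card T = cis (real (card T) * (2 * pi / right.total * ?phase a))"
      using a unfolding g_def by (simp only: if_True Complex.DeMoivre)
    also have "real (card T) * (2 * pi / right.total * ?phase a) = 2 * ?phase a"
      using cardT by (simp add: total)
    finally show ?thesis
      unfolding cis .
  qed
  have "finite {u :: complex. u ^ card T = -1}"
    using cardT by (intro finite_nth_roots) simp
  moreover have "range g \<subseteq> {u. u ^ card T = -1} \<union> g ` E"
    using g_root dom by blast
  ultimately have "finite (range g)"
    using assms(1) by (meson finite_UnI finite_imageI finite_subset)
  moreover have "connected (range g)"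
    using cont_g by (intro connected_continuous_image continuous_at_imp_continuous_on) (auto simp: connected_UNIV)
  ultimately obtain u where u: "range g \<subseteq> {u}"
    by (metis connected_finite_iff_sing empty_subsetI order_refl)
  have g_eq: "g a = u" for a
    using u by blast
  obtain a0 where a0: "a0 \<in> dom b"
    using dom assms(1) by (metis ComplI ex_new_if_finite infinite_UNIV_char_0 subsetD)
  define c where "c = ?phase a0"
  have u_eq: "u = cis (2 * pi / right.total * c)"
    using g_eq[of a0] a0 by (simp add: g_def c_def)
  have shift: "\<exists>n. p = c + of_int n * right.total" if "cis (2 * pi / right.total * p) = u" for p
  proof -
    have "cis (2 * pi / right.total * p - 2 * pi / right.total * c) = 1"
      using that u_eq by (simp add: cis_divide[symmetric])
    then have "cos (2 * pi / right.total * p - 2 * pi / right.total * c) = 1"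
      by (simp add: complex_eq_iff)
    then obtain n where eq: "2 * pi / right.total * p - 2 * pi / right.total * c = of_int n * (2 * pi)"
      unfolding cos_one_2pi_int by (metis mult.assoc)
    show ?thesis
    proof (intro exI)
      have "2 * pi / right.total * (p - c) = 2 * pi / right.total * (of_int n * right.total)"
        using right.total_pos by (subst right_diff_distrib, subst eq) simp
      then have "p - c = of_int n * right.total"
        using right.total_pos by (subst (asm) mult_left_cancel) simp_all
      then show "p = c + of_int n * right.total" by simp
    qed
  qed
  have "follows b c"
    unfolding follows_def
  proof (intro allI iffI)
    fix \<alpha> \<beta> assume "b \<alpha> = Some \<beta>"
    then show "\<exists>n. left.angle \<alpha> + right.angle \<beta> = c + of_int n * right.total"
      using g_eq[of \<alpha>] by (intro shift) (simp add: g_def dom_def)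
  next
    fix \<alpha> \<beta> assume "\<exists>n. left.angle \<alpha> + right.angle \<beta> = c + of_int n * right.total"
    then obtain n where n: "left.angle \<alpha> + right.angle \<beta> = c + of_int n * right.total" ..
    show "b \<alpha> = Some \<beta>"
    proof (cases "b \<alpha>")
      case None
      then have "cis (2 * pi / right.total * left.angle \<alpha>) = u"
        using g_eq[of \<alpha>] by (simp add: g_def dom_def)
      then obtain k where "left.angle \<alpha> = c + of_int k * right.total"
        using shift by blast
      with n show ?thesis
        using right_angle_not_multiple by blast
    next
      case (Some \<beta>')
      then have "cis (2 * pi / right.total * (left.angle \<alpha> + right.angle \<beta>')) = u"
        using g_eq[of \<alpha>] by (simp add: g_def dom_def)
      then obtain k where "left.angle \<alpha> + right.angle \<beta>' = c + of_int k * right.total"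
        using shift by blast
      with n have "\<beta> = \<beta>'"
        by (rule right_angle_unique)
      with Some show ?thesis by simp
    qed
  qed
  moreover have "cos c = 0"
    unfolding c_def by (rule relation[OF a0])
  ultimately show ?thesis by blast
qed

end

section \<open>Eigenvector expansions for a self-adjoint operator\<close>

lemma cinner_add_right: "cinner u (v + w) = cinner u v + cinner u (w :: 'h::fin_dim_hilbert)"
  by (metis cinner_add_left cinner_commute complex_cnj_add)

lemma cinner_scaleC_right: "cinner u (c *\<^sub>C v) = cnj c * cinner u (v :: 'h::fin_dim_hilbert)"
  by (metis cinner_commute cinner_scaleC_left complex_cnj_mult)

lemma cinner_zero_left [simp]: "cinner 0 (v :: 'h::fin_dim_hilbert) = 0"
  using cinner_add_left[of 0 0 v] by simp

lemma cinner_zero_right [simp]: "cinner (v :: 'h::fin_dim_hilbert) 0 = 0"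
  using cinner_add_right[of v 0 0] by simp

lemma cinner_diff_left: "cinner (u - v) w = cinner u w - cinner v (w :: 'h::fin_dim_hilbert)"
  using cinner_add_left[of "u - v" v w] by simp

lemma cinner_sum_left: "cinner (\<Sum>i\<in>I. g i) (v :: 'h::fin_dim_hilbert) = (\<Sum>i\<in>I. cinner (g i) v)"
  by (induction I rule: infinite_finite_induct) (simp_all add: cinner_add_left)

lemma cinner_sum_right: "cinner (v :: 'h::fin_dim_hilbert) (\<Sum>i\<in>I. g i) = (\<Sum>i\<in>I. cinner v (g i))"
  by (induction I rule: infinite_finite_induct) (simp_all add: cinner_add_right)

lemma cinner_self: "cinner v v = complex_of_real (Re (cinner v (v :: 'h::fin_dim_hilbert)))"
  by (metis Reals_cnj_iff cinner_commute of_real_Re)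

lemma cinner_self_pos: "v \<noteq> 0 \<Longrightarrow> 0 < Re (cinner v (v :: 'h::fin_dim_hilbert))"
  by (metis cinner_eq_zero_iff cinner_nonneg cinner_self less_eq_real_def of_real_0)

lemma cinner_eq_0_commute: "cinner u v = 0 \<longleftrightarrow> cinner v (u :: 'h::fin_dim_hilbert) = 0"
  by (metis cinner_commute complex_cnj_zero)

lemma finite_span_UNIV: "\<exists>F :: 'h::fin_dim_hilbert set. finite F \<and> cvec.span F = UNIV"
proof -
  obtain F :: "'h set" where F: "finite F" "\<And>v. \<exists>c. v = (\<Sum>u\<in>F. c u *\<^sub>C u)"
    using finite_spanning_set by blast
  have "v \<in> cvec.span F" for v
  proof -
    obtain c where c: "v = (\<Sum>u\<in>F. c u *\<^sub>C u)"
      using F(2) by blast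
    show ?thesis
      unfolding c by (intro cvec.span_sum cvec.span_scale cvec.span_base)
  qed
  with F(1) show ?thesis by blast
qed

lemma independent_finite:
  assumes "cvec.independent (V :: 'h::fin_dim_hilbert set)"
  shows "finite V"
  using finite_span_UNIV cvec.independent_span_bound[OF _ assms] by blast

locale self_adjoint_op =
  fixes X :: "'h::fin_dim_hilbert \<Rightarrow> 'h"
  assumes self_adjoint: "self_adjoint X"
begin

lemma add: "X (u + v) = X u + X v"
  and scale: "X (c *\<^sub>C u) = c *\<^sub>C X u"
  and adjoint: "cinner (X u) v = cinner u (X v)"
  using self_adjoint unfolding self_adjoint_def Vector_Spaces.linear_iff by blast+

lemma zero [simp]: "X 0 = 0"
  using scale[of 0 0] by simp

lemma diff: "X (u - v) = X u - X v"
  using add[of "u - v" v] by (simp add: algebra_simps)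

lemma sum: "X (\<Sum>i\<in>I. g i) = (\<Sum>i\<in>I. X (g i))"
  by (induction I rule: infinite_finite_induct) (simp_all add: add)

lemma eigenvalue_real:
  assumes "X v = \<mu> *\<^sub>C v" "v \<noteq> 0"
  shows "cnj \<mu> = \<mu>"
proof -
  have "\<mu> * cinner v v = cnj \<mu> * cinner v v"
    using adjoint[of v v] by (simp add: assms(1) cinner_scaleC_left cinner_scaleC_right)
  then show ?thesis
    using assms(2) by (simp add: cinner_eq_zero_iff)
qed

lemma shift_adjoint:
  "cinner (X u - of_real \<mu> *\<^sub>C u) v = cinner u (X v - of_real \<mu> *\<^sub>C v)"
proof -
  have "cinner u (X v - of_real \<mu> *\<^sub>C v) = cinner u (X v + of_real (- \<mu>) *\<^sub>C v)"
    by simp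
  then show ?thesis
    unfolding cinner_diff_left cinner_add_right cinner_scaleC_right
    by (simp add: adjoint cinner_scaleC_left)
qed

lemma eigenvectors_orthogonal:
  assumes "X u = of_real r *\<^sub>C u" "X v = of_real s *\<^sub>C v" "r \<noteq> s"
  shows "cinner u v = 0"
proof -
  have "of_real r * cinner u v = of_real s * cinner u v"
    using adjoint[of u v] by (simp add: assms(1,2) cinner_scaleC_left cinner_scaleC_right)
  then show ?thesis using assms(3) by simp
qed

text \<open>
The kernel of \<open>(X - \<mu>)\<^sup>2\<close> is that of \<open>X - \<mu>\<close>: an eigenvector \<open>w = (X - \<mu>)u\<close> has a real eigenvalue, and then
\<open>\<langle>w, w\<rangle> = \<langle>u, (X - \<mu>)w\<rangle> = 0\<close>.
\<close>
lemma shift_twice_eq_0: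
  assumes "X w - \<mu> *\<^sub>C w = 0" and w: "w = X u - \<mu> *\<^sub>C u"
  shows "w = 0"
proof (rule ccontr)
  assume "w \<noteq> 0"
  then have "cnj \<mu> = \<mu>"
    using eigenvalue_real assms(1) by simp
  then obtain r where r: "\<mu> = of_real r"
    by (metis Reals_cases Reals_cnj_iff)
  have "cinner w w = cinner u (X w - \<mu> *\<^sub>C w)"
    using shift_adjoint[of u r w] by (simp add: r w)
  then show False
    using \<open>w \<noteq> 0\<close> assms(1) by (simp add: cinner_eq_zero_iff)
qed

text \<open>
The vector \<open>p(X) v\<close>, evaluated by the Horner scheme.
\<close>
definition poly_op :: "complex poly \<Rightarrow> 'h \<Rightarrow> 'h"
  where "poly_op p v = fold_coeffs (\<lambda>a u. a *\<^sub>C v + X u) p 0"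

lemma poly_op_0 [simp]: "poly_op 0 v = 0"
  by (simp add: poly_op_def)

lemma poly_op_pCons [simp]: "poly_op (pCons a p) v = a *\<^sub>C v + X (poly_op p v)"
  by (cases "p = 0"; cases "a = 0") (simp_all add: poly_op_def)

lemma poly_op_zero_vector [simp]: "poly_op p 0 = 0"
  by (induction p) simp_all

lemma poly_op_add: "poly_op (p + q) v = poly_op p v + poly_op q v"
  by (induction p q rule: poly_induct2) (simp_all add: add scaleC_add_left algebra_simps)

lemma poly_op_smult: "poly_op (smult c p) v = c *\<^sub>C poly_op p v"
  by (induction p) (simp_all add: scale scaleC_add_right scaleC_scaleC)

lemma poly_op_minus: "poly_op (- p) v = - poly_op p v"
  using poly_op_smult[of "-1" p v] by simp

lemma poly_op_diff: "poly_op (p - q) v = poly_op p v - poly_op q v"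
  using poly_op_add[of p "- q" v] by (simp add: poly_op_minus)

lemma poly_op_mult: "poly_op (p * q) v = poly_op p (poly_op q v)"
  by (induction p) (simp_all add: poly_op_add poly_op_smult)

lemma poly_op_1 [simp]: "poly_op 1 v = v"
  by (simp add: one_pCons scaleC_one)

lemma poly_op_linear_factor: "poly_op [:- \<mu>, 1:] v = X v - \<mu> *\<^sub>C v"
  by (simp add: scaleC_one)

lemma poly_op_monom: "poly_op (monom c i) v = c *\<^sub>C (X ^^ i) v"
  by (induction i) (simp_all add: monom_0 monom_Suc scale)

lemma poly_op_sum: "poly_op (\<Sum>i\<in>I. p i) v = (\<Sum>i\<in>I. poly_op (p i) v)"
  by (induction I rule: infinite_finite_induct) (simp_all add: poly_op_add)

text \<open>
Otherwise the iterates \<open>X\<^sup>i v\<close> would be infinitely many independent vectors.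
\<close>
lemma annihilating_polynomial: "\<exists>p. p \<noteq> 0 \<and> poly_op p v = 0"
proof (rule ccontr)
  assume "\<not> ?thesis"
  then have free: "p = 0" if "poly_op p v = 0" for p
    using that by blast
  let ?e = "\<lambda>i. (X ^^ i) v"
  have inj: "inj ?e"
  proof (rule injI)
    fix i j assume "?e i = ?e j"
    then have "monom 1 i - monom 1 j = (0 :: complex poly)"
      by (intro free) (simp add: poly_op_diff poly_op_monom)
    then have "degree (monom (1 :: complex) i) = degree (monom (1 :: complex) j)"
      by simp
    then show "i = j"
      by (simp add: degree_monom_eq)
  qed
  have "cvec.independent (range ?e)"
  proof
    assume "cvec.dependent (range ?e)"
    then obtain t u y where t: "finite t" "t \<subseteq> range ?e" "(\<Sum>y\<in>t. u y *\<^sub>C y) = 0" "y \<in> t" "u y \<noteq> 0"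
      unfolding cvec.dependent_explicit by blast
    define I where "I = ?e -` t"
    have I: "finite I" "?e ` I = t"
      using t inj by (auto simp: I_def finite_vimageI)
    let ?p = "\<Sum>i\<in>I. monom (u (?e i)) i"
    have "poly_op ?p v = (\<Sum>i\<in>I. u (?e i) *\<^sub>C ?e i)"
      by (simp add: poly_op_sum poly_op_monom)
    also have "\<dots> = (\<Sum>y\<in>?e ` I. u y *\<^sub>C y)"
      using inj by (subst sum.reindex) (auto simp: inj_def inj_on_def)
    finally have "?p = 0"
      using t I by (intro free) simp
    moreover obtain i where i: "i \<in> I" "?e i = y"
      using t I by blast
    have "coeff ?p i = u y"
      using i I by (simp add: coeff_sum sum.delta)
    ultimately show False using t by simp
  qed
  then have "finite (range ?e)"
    by (rule independent_finite)
  with inj show False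
    by (simp add: finite_image_iff)
qed

text \<open>
Eigenvectors are indexed by all real numbers, with value \<open>0\<close> outside the finite set, so that two
such sums can be added termwise.
\<close>
definition eigensum :: "'h \<Rightarrow> bool"
  where "eigensum v \<longleftrightarrow> (\<exists>S g. finite S \<and> (\<forall>s. X (g s) = of_real s *\<^sub>C g s) \<and>
    (\<forall>s. s \<notin> S \<longrightarrow> g s = 0) \<and> v = (\<Sum>s\<in>S. g s))"

lemma eigensum_eigenvector:
  assumes "X v = \<mu> *\<^sub>C v"
  shows "eigensum v"
proof (cases "v = 0")
  case True
  then show ?thesis
    unfolding eigensum_def by (intro exI[of _ "{}"] exI[of _ "\<lambda>_. 0"]) simp
next
  case False
  then obtain r where "\<mu> = of_real r"
    using eigenvalue_real[OF assms] by (metis Reals_cases Reals_cnj_iff)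
  then show ?thesis
    using assms unfolding eigensum_def
    by (intro exI[of _ "{r}"] exI[of _ "\<lambda>s. if s = r then v else 0"]) simp
qed

lemma eigensum_add:
  assumes "eigensum u" "eigensum v"
  shows "eigensum (u + v)"
proof -
  obtain S g where S: "finite S" "\<And>s. X (g s) = of_real s *\<^sub>C g s" "\<And>s. s \<notin> S \<Longrightarrow> g s = 0" "u = (\<Sum>s\<in>S. g s)"
    using assms(1) unfolding eigensum_def by blast
  obtain T h where T: "finite T" "\<And>s. X (h s) = of_real s *\<^sub>C h s" "\<And>s. s \<notin> T \<Longrightarrow> h s = 0" "v = (\<Sum>s\<in>T. h s)"
    using assms(2) unfolding eigensum_def by blast
  have "u = (\<Sum>s\<in>S \<union> T. g s)" "v = (\<Sum>s\<in>S \<union> T. h s)"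
    unfolding S(4) T(4) using S T by (auto intro!: sum.mono_neutral_left)
  then show ?thesis
    unfolding eigensum_def using S T
    by (intro exI[of _ "S \<union> T"] exI[of _ "\<lambda>s. g s + h s"])
      (auto simp: sum.distrib add scaleC_add_right)
qed

text \<open>
Split off a linear factor, \<open>p = (x - \<mu>) q\<close>, so that \<open>q(X)v\<close> satisfies the eigenvector equation for
\<open>\<mu>\<close>. If \<open>\<mu>\<close> is a root of \<open>q\<close>, then already \<open>q(X)v = 0\<close> because \<open>X\<close> is self-adjoint. Otherwise subtract the multiple
\<open>q(X)v / q(\<mu>)\<close> from \<open>v\<close>; the rest is annihilated by \<open>q\<close>, since \<open>1 - q / q(\<mu>)\<close> is divisible by \<open>x - \<mu>\<close>.
\<close>
lemma annihilated_eigensum: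
  assumes "p \<noteq> 0" "poly_op p v = 0"
  shows "eigensum v"
  using assms
proof (induction "degree p" arbitrary: p v rule: less_induct)
  case less
  show ?case
  proof (cases "degree p = 0")
    case True
    then obtain c where c: "p = [:c:]"
      by (metis degree_eq_zeroE)
    then have "v = 0"
      using less.prems by simp
    then show ?thesis
      using eigensum_eigenvector[of v 0] by simp
  next
    case False
    then obtain \<mu> where "poly p \<mu> = 0"
      using fundamental_theorem_of_algebra constant_degree by metis
    then obtain q where p: "p = [:- \<mu>, 1:] * q"
      by (metis dvdE poly_eq_0_iff_dvd)
    have q0: "q \<noteq> 0"
      using less.prems p by auto
    have "degree p = degree [:- \<mu>, 1:] + degree q"
      unfolding p by (rule degree_mult_eq) (use q0 in auto)
    with q0 have q: "q \<noteq> 0" "degree q < degree p"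
      by auto
    let ?w = "poly_op q v"
    have w: "X ?w - \<mu> *\<^sub>C ?w = 0"
      using less.prems(2) unfolding p poly_op_mult poly_op_linear_factor .
    show ?thesis
    proof (cases "poly q \<mu> = 0")
      case True
      then obtain q' where "q = [:- \<mu>, 1:] * q'"
        by (metis dvdE poly_eq_0_iff_dvd)
      then have "?w = X (poly_op q' v) - \<mu> *\<^sub>C poly_op q' v"
        by (simp only: poly_op_mult poly_op_linear_factor)
      then have "?w = 0"
        using shift_twice_eq_0 w by blast
      then show ?thesis
        using less.hyps q by blast
    next
      case False
      let ?c = "inverse (poly q \<mu>)"
      have "poly (1 - smult ?c q) \<mu> = 0"
        using False by simp
      then obtain r where r: "1 - smult ?c q = [:- \<mu>, 1:] * r"
        by (metis dvdE poly_eq_0_iff_dvd)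
      let ?u = "poly_op (1 - smult ?c q) v"
      have "poly_op q ?u = poly_op (r * p) v"
        unfolding r p by (simp only: poly_op_mult[symmetric] ac_simps)
      then have "eigensum ?u"
        using less.hyps q less.prems(2) by (simp add: poly_op_mult)
      moreover have "eigensum (?c *\<^sub>C ?w)"
        using w by (intro eigensum_eigenvector[of _ \<mu>]) (simp add: scale cvec.scale_left_commute)
      moreover have "v = ?u + ?c *\<^sub>C ?w"
        by (simp add: poly_op_diff poly_op_smult)
      ultimately show ?thesis
        using eigensum_add by metis
    qed
  qed
qed

lemma eigensum: "eigensum v"
  using annihilating_polynomial annihilated_eigensum by blast

lemma spectral_decomposition:
  obtains S g where "finite S" "\<And>s. s \<in> S \<Longrightarrow> X (g s) = of_real s *\<^sub>C g s"
    "\<And>s. s \<in> S \<Longrightarrow> g s \<noteq> 0" "v = (\<Sum>s\<in>S. g s)"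
proof -
  obtain S g where S: "finite S" "\<And>s. X (g s) = of_real s *\<^sub>C g s" "v = (\<Sum>s\<in>S. g s)"
    using eigensum[of v] unfolding eigensum_def by blast
  show ?thesis
  proof
    show "v = (\<Sum>s\<in>{s \<in> S. g s \<noteq> 0}. g s)"
      unfolding S(3) using S(1) by (auto intro!: sum.mono_neutral_right)
  qed (use S in auto)
qed

lemma Spec_real:
  assumes "\<mu> \<in> Spec X"
  shows "\<mu> = of_real (Re \<mu>)"
proof -
  obtain v where "X v = \<mu> *\<^sub>C v" "v \<noteq> 0"
    using assms by (auto simp: Spec_on_def eigenspace_on_def)
  from eigenvalue_real[OF this] show ?thesis
    by (simp add: complex_eq_iff)
qed

text \<open>
Eigenvectors for distinct eigenvalues are orthogonal, hence independent.
\<close>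
lemma finite_Spec: "finite (Spec X)"
proof -
  define e where "e \<mu> = (SOME v. X v = \<mu> *\<^sub>C v \<and> v \<noteq> 0)" for \<mu>
  have e: "X (e \<mu>) = \<mu> *\<^sub>C e \<mu>" "e \<mu> \<noteq> 0" if "\<mu> \<in> Spec X" for \<mu>
    using that someI_ex[of "\<lambda>v. X v = \<mu> *\<^sub>C v \<and> v \<noteq> 0"]
    unfolding e_def Spec_on_def eigenspace_on_def by auto
  have orth: "cinner (e \<mu>) (e \<nu>) = 0" if "\<mu> \<in> Spec X" "\<nu> \<in> Spec X" "\<mu> \<noteq> \<nu>" for \<mu> \<nu>
  proof (rule eigenvectors_orthogonal)
    show "X (e \<mu>) = of_real (Re \<mu>) *\<^sub>C e \<mu>" "X (e \<nu>) = of_real (Re \<nu>) *\<^sub>C e \<nu>"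
      using e(1) that Spec_real by simp_all
    show "Re \<mu> \<noteq> Re \<nu>"
      using that Spec_real by metis
  qed
  have inj: "inj_on e (Spec X)"
  proof (rule inj_onI, rule ccontr)
    fix \<mu> \<nu> assume "\<mu> \<in> Spec X" "\<nu> \<in> Spec X" "e \<mu> = e \<nu>" "\<mu> \<noteq> \<nu>"
    then show False
      using orth[of \<mu> \<nu>] e(2)[of \<nu>] by (simp add: cinner_eq_zero_iff)
  qed
  have "cvec.independent (e ` Spec X)"
  proof
    assume "cvec.dependent (e ` Spec X)"
    then obtain t u y where t: "finite t" "t \<subseteq> e ` Spec X" "(\<Sum>y\<in>t. u y *\<^sub>C y) = 0" "y \<in> t" "u y \<noteq> 0"
      unfolding cvec.dependent_explicit by blast
    have "cinner y' y = 0" if "y' \<in> t - {y}" for y'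
    proof -
      have "y' \<in> e ` Spec X" "y \<in> e ` Spec X" "y' \<noteq> y"
        using that t(2,4) by blast+
      then show ?thesis
        using orth by auto
    qed
    then have "cinner (\<Sum>x\<in>t - {y}. u x *\<^sub>C x) y = 0"
      unfolding cinner_sum_left by (intro sum.neutral) (simp add: cinner_scaleC_left)
    then have "cinner (\<Sum>x\<in>t. u x *\<^sub>C x) y = u y * cinner y y"
      unfolding sum.remove[OF t(1,4)] cinner_add_left by (simp add: cinner_scaleC_left)
    moreover obtain \<mu> where "\<mu> \<in> Spec X" "y = e \<mu>"
      using t(2,4) by blast
    then have "y \<noteq> 0"
      using e(2) by simp
    ultimately show False
      using t(3,5) by (simp add: cinner_eq_zero_iff)
  qed
  then have "finite (e ` Spec X)"
    by (rule independent_finite)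
  with inj show ?thesis
    by (simp add: finite_image_iff)
qed

end

section \<open>The pole sum of a unit vector\<close>

lemma cvec_dim_less_iff:
  fixes U V :: "'h::fin_dim_hilbert set"
  assumes "cvec.subspace U" "cvec.subspace V" "U \<subseteq> V"
  shows "cvec.dim U < cvec.dim V \<longleftrightarrow> \<not> V \<subseteq> U"
proof -
  obtain B :: "'h set" where B: "cvec.independent B" "UNIV \<subseteq> cvec.span B"
    by (rule cvec.maximal_independent_subset[of "UNIV :: 'h set"])
  interpret fd: finite_dimensional_vector_space "scaleC :: complex \<Rightarrow> 'h \<Rightarrow> 'h" B
    by unfold_locales (use B independent_finite in auto)
  show ?thesis
  proof (cases "V \<subseteq> U")
    case True
    then have "U = V" using assms(3) by blast
    then show ?thesis by simp
  next
    case False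
    then have "\<not> cvec.dim V \<le> cvec.dim U"
      using fd.subspace_dim_equal[OF assms] by blast
    with False show ?thesis by simp
  qed
qed

lemma orth_compl_line: "v \<in> orth_compl (Z_line z) \<longleftrightarrow> cinner v (z :: 'h::fin_dim_hilbert) = 0"
  unfolding orth_compl_def cvec.span_singleton
  by (auto simp: cinner_scaleC_right)

lemma P_proj_unit:
  assumes "cnorm (z :: 'h::fin_dim_hilbert) = 1"
  shows "P_proj z v = cinner v z *\<^sub>C z"
proof -
  have unit: "cinner z z = 1"
    using assms cinner_self[of z] by (simp add: cnorm_def)
  show ?thesis
    unfolding orth_proj_def
  proof (rule the_equality)
    show "cinner v z *\<^sub>C z \<in> Z_line z \<and> v - cinner v z *\<^sub>C z \<in> orth_compl (Z_line z)"
      unfolding orth_compl_line by (simp add: cvec.span_base cvec.span_scale cinner_diff_left cinner_scaleC_left unit)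
    fix u assume u: "u \<in> Z_line z \<and> v - u \<in> orth_compl (Z_line z)"
    then obtain c where "u = c *\<^sub>C z"
      unfolding cvec.span_singleton by blast
    with u show "u = cinner v z *\<^sub>C z"
      unfolding orth_compl_line by (simp add: cinner_diff_left cinner_scaleC_left unit)
  qed
qed

context self_adjoint_op
begin

lemma resolvent_eqI:
  assumes "\<mu> \<notin> Spec X" "X v - \<mu> *\<^sub>C v = w"
  shows "resolvent X \<mu> w = v"
proof -
  have "inj (\<lambda>v. X v - \<mu> *\<^sub>C v)"
  proof (rule injI)
    fix u v assume "X u - \<mu> *\<^sub>C u = X v - \<mu> *\<^sub>C v"
    then have "X (u - v) = \<mu> *\<^sub>C (u - v)"
      by (simp add: diff cvec.scale_right_diff_distrib algebra_simps)
    then show "u = v"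
      using assms(1) by (auto simp: Spec_on_def eigenspace_on_def)
  qed
  then show ?thesis
    unfolding resolvent_def using assms(2) inv_f_f by fastforce
qed

lemma subspace_eigenspace: "cvec.subspace (eigenspace X \<mu>)"
  by (auto simp: cvec.subspace_def eigenspace_on_def add scale scaleC_add_right cvec.scale_left_commute)

end

text \<open>
The numbers in \<open>S\<close> are the eigenvalues that \<open>z\<close> sees, and \<open>g s\<close> is the component of \<open>z\<close> in the
eigenspace of \<open>s\<close>.
\<close>
locale spectral_vector = self_adjoint_op X for X :: "'h::fin_dim_hilbert \<Rightarrow> 'h" +
  fixes z :: 'h and S :: "real set" and g :: "real \<Rightarrow> 'h"
  assumes unit: "cnorm z = 1"
    and finite_S: "finite S"
    and eigen: "\<And>s. s \<in> S \<Longrightarrow> X (g s) = of_real s *\<^sub>C g s"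
    and g_nonzero: "\<And>s. s \<in> S \<Longrightarrow> g s \<noteq> 0"
    and z_eq: "z = (\<Sum>s\<in>S. g s)"
begin

definition weight :: "real \<Rightarrow> real"
  where "weight s = Re (cinner (g s) (g s))"

abbreviation F :: "real \<Rightarrow> real"
  where "F \<equiv> pole_sum S weight"

lemma cinner_z_z: "cinner z z = 1"
  using unit cinner_self[of z] by (simp add: cnorm_def)

lemma nonempty_S: "S \<noteq> {}"
  using cinner_z_z z_eq by auto

lemma weight_pos: "s \<in> S \<Longrightarrow> 0 < weight s"
  unfolding weight_def by (rule cinner_self_pos) (rule g_nonzero)

lemma herglotz: "herglotz S weight"
  by unfold_locales (use finite_S nonempty_S weight_pos in auto)

lemma cinner_g_z:
  assumes "s \<in> S"
  shows "cinner (g s) z = of_real (weight s)"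
proof -
  have "cinner (g s) (g t) = 0" if "t \<in> S - {s}" for t
    using that assms eigen by (intro eigenvectors_orthogonal[of _ s _ t]) auto
  then have "cinner (g s) (\<Sum>t\<in>S. g t) = cinner (g s) (g s)"
    using finite_S assms by (simp add: cinner_sum_right cinner_add_right sum.remove)
  then show ?thesis
    unfolding z_eq[symmetric] weight_def using cinner_self[of "g s"] by simp
qed

text \<open>
The solution of \<open>(X - \<mu>)v = z\<close> in the span of the components of \<open>z\<close>. It exists also at those eigenvalues
that are not in \<open>S\<close>, where \<open>X - \<mu>\<close> is not invertible.
\<close>
definition res :: "real \<Rightarrow> 'h"
  where "res \<mu> = (\<Sum>s\<in>S. of_real (1 / (s - \<mu>)) *\<^sub>C g s)"

definition res2 :: "real \<Rightarrow> 'h"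
  where "res2 \<mu> = (\<Sum>s\<in>S. of_real (1 / (s - \<mu>)\<^sup>2) *\<^sub>C g s)"

lemma shift_combination:
  "X (\<Sum>s\<in>S. of_real (c s) *\<^sub>C g s) - of_real \<mu> *\<^sub>C (\<Sum>s\<in>S. of_real (c s) *\<^sub>C g s) =
    (\<Sum>s\<in>S. of_real (c s * (s - \<mu>)) *\<^sub>C g s)"
proof -
  have "of_real (c s) *\<^sub>C X (g s) - of_real \<mu> *\<^sub>C of_real (c s) *\<^sub>C g s = of_real (c s * (s - \<mu>)) *\<^sub>C g s"
    if "s \<in> S" for s
    unfolding eigen[OF that] scaleC_scaleC cvec.scale_left_diff_distrib[symmetric]
    by (simp add: algebra_simps)
  then show ?thesis
    by (simp add: sum scale cvec.scale_sum_right sum_subtractf[symmetric])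
qed

lemma cinner_combination:
  "cinner (\<Sum>s\<in>S. of_real (c s) *\<^sub>C g s) z = of_real (\<Sum>s\<in>S. weight s * c s)"
  by (simp add: cinner_sum_left cinner_scaleC_left cinner_g_z mult.commute)

lemma shift_res:
  assumes "\<mu> \<notin> S"
  shows "X (res \<mu>) - of_real \<mu> *\<^sub>C res \<mu> = z"
proof -
  have "1 / (s - \<mu>) * (s - \<mu>) = 1" if "s \<in> S" for s
    using that assms by auto
  then show ?thesis
    unfolding res_def shift_combination z_eq by (simp add: scaleC_one cong: sum.cong)
qed

lemma shift_res2:
  assumes "\<mu> \<notin> S"
  shows "X (res2 \<mu>) - of_real \<mu> *\<^sub>C res2 \<mu> = res \<mu>"
proof -
  have "1 / (s - \<mu>)\<^sup>2 * (s - \<mu>) = 1 / (s - \<mu>)" if "s \<in> S" for s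
    using that assms by (auto simp: power2_eq_square)
  then show ?thesis
    unfolding res_def res2_def shift_combination by (simp cong: sum.cong)
qed

lemma cinner_res: "cinner (res \<mu>) z = of_real (F \<mu>)"
  unfolding res_def cinner_combination pole_sum_def by simp

lemma cinner_res2: "cinner (res2 \<mu>) z = of_real (pole_sum_deriv S weight \<mu>)"
  unfolding res2_def cinner_combination pole_sum_deriv_def by simp

text \<open>
The key computation. For \<open>\<mu> \<notin> S\<close> write \<open>z = (X - \<mu>) res \<mu>\<close> and move \<open>X - \<mu>\<close> to the other side of the inner product;
for \<open>\<mu> \<in> S\<close> take the inner product of the equation with the eigenvector \<open>g \<mu>\<close>. Eigenvalues hidden from \<open>z\<close>,
where \<open>X - \<mu>\<close> is singular but \<open>\<mu> \<notin> S\<close>, fall under the first case.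
\<close>
lemma shift_eq_multiple:
  assumes "X v - of_real \<mu> *\<^sub>C v = c *\<^sub>C z"
  shows "\<mu> \<notin> S \<Longrightarrow> cinner v z = c * of_real (F \<mu>)" and "\<mu> \<in> S \<Longrightarrow> c = 0"
proof -
  assume "\<mu> \<notin> S"
  have "cinner v z = cinner (X v - of_real \<mu> *\<^sub>C v) (res \<mu>)"
    unfolding shift_adjoint shift_res[OF \<open>\<mu> \<notin> S\<close>] ..
  also have "\<dots> = c * cinner z (res \<mu>)"
    unfolding assms by (rule cinner_scaleC_left)
  also have "cinner z (res \<mu>) = of_real (F \<mu>)"
    unfolding cinner_commute[of z] cinner_res by simp
  finally show "cinner v z = c * of_real (F \<mu>)" .
next
  assume "\<mu> \<in> S"
  have "c * cinner z (g \<mu>) = cinner v (X (g \<mu>) - of_real \<mu> *\<^sub>C g \<mu>)"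
    unfolding shift_adjoint[symmetric] assms by (rule cinner_scaleC_left[symmetric])
  then have "c * cinner z (g \<mu>) = 0"
    by (simp add: eigen[OF \<open>\<mu> \<in> S\<close>])
  moreover have "cinner z (g \<mu>) = of_real (weight \<mu>)"
    unfolding cinner_commute[of z] cinner_g_z[OF \<open>\<mu> \<in> S\<close>] by simp
  ultimately show "c = 0"
    using weight_pos[OF \<open>\<mu> \<in> S\<close>] by simp
qed

lemma visible_eigenvalue_iff: "of_real \<mu> \<in> Spec X - Gam_tilde z X \<longleftrightarrow> \<mu> \<in> S"
proof
  assume "of_real \<mu> \<in> Spec X - Gam_tilde z X"
  then obtain v where v: "X v = of_real \<mu> *\<^sub>C v" "cinner z v \<noteq> 0"
    by (auto simp: Gam_tilde_def eigenspace_on_def)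
  show "\<mu> \<in> S"
  proof (rule ccontr)
    assume "\<mu> \<notin> S"
    then have "cinner v z = 0"
      using shift_eq_multiple(1)[of v \<mu> 0] v(1) by simp
    with v(2) show False
      using cinner_eq_0_commute by blast
  qed
next
  assume \<mu>: "\<mu> \<in> S"
  then have "cinner z (g \<mu>) \<noteq> 0"
    using cinner_g_z[OF \<mu>] weight_pos[OF \<mu>] cinner_eq_0_commute[of z "g \<mu>"] by simp
  then show "of_real \<mu> \<in> Spec X - Gam_tilde z X"
    using eigen[OF \<mu>] g_nonzero[OF \<mu>] by (auto simp: Gam_tilde_def Spec_on_def eigenspace_on_def)
qed

lemma visible_in_Spec: "\<mu> \<in> S \<Longrightarrow> of_real \<mu> \<in> Spec X"
  using visible_eigenvalue_iff by blast

lemma GamI: "X v = \<mu> *\<^sub>C v \<Longrightarrow> v \<noteq> 0 \<Longrightarrow> cinner v z = 0 \<Longrightarrow> \<mu> \<in> Gam z X"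
  using cinner_eq_0_commute[of v z] by (auto simp: Gam_def Spec_on_def eigenspace_on_def)

lemma resolvent_z:
  assumes "of_real \<mu> \<notin> Spec X"
  shows "resolvent X (of_real \<mu>) (c *\<^sub>C z) = c *\<^sub>C res \<mu>"
proof -
  have "\<mu> \<notin> S" using assms visible_in_Spec by blast
  then have eq: "X (res \<mu>) - of_real \<mu> *\<^sub>C res \<mu> = z"
    by (rule shift_res)
  have "X (c *\<^sub>C res \<mu>) - of_real \<mu> *\<^sub>C c *\<^sub>C res \<mu> = c *\<^sub>C z"
    unfolding scale cvec.scale_left_commute[of "of_real \<mu>" c] cvec.scale_right_diff_distrib[symmetric] eq ..
  then show ?thesis
    using resolvent_eqI assms by blast
qed

lemma resolvent_z_z:
  assumes "of_real \<mu> \<notin> Spec X"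
  shows "cinner (resolvent X (of_real \<mu>) z) z = of_real (F \<mu>)"
    "cinner (resolvent X (of_real \<mu>) (resolvent X (of_real \<mu>) z)) z = of_real (pole_sum_deriv S weight \<mu>)"
proof -
  have "\<mu> \<notin> S" using assms visible_in_Spec by blast
  then have "resolvent X (of_real \<mu>) z = res \<mu>" "resolvent X (of_real \<mu>) (res \<mu>) = res2 \<mu>"
    using resolvent_eqI[OF assms] shift_res shift_res2 by blast+
  then show "cinner (resolvent X (of_real \<mu>) z) z = of_real (F \<mu>)"
    "cinner (resolvent X (of_real \<mu>) (resolvent X (of_real \<mu>) z)) z = of_real (pole_sum_deriv S weight \<mu>)"
    by (simp_all add: cinner_res cinner_res2)
qed

text \<open>
On the orthogonal complement of \<open>z\<close>, compressing \<open>X\<close> means calculating modulo multiples of \<open>z\<close>.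
\<close>
lemma eigenspace_perp_iff:
  "v \<in> eigenspace_perp z X \<mu> \<longleftrightarrow> cinner v z = 0 \<and> (\<exists>c. X v - \<mu> *\<^sub>C v = c *\<^sub>C z)"
proof -
  have "X v - cinner (X v) z *\<^sub>C z = \<mu> *\<^sub>C v"
    if "cinner v z = 0" "X v - \<mu> *\<^sub>C v = c *\<^sub>C z" for c
  proof -
    have "X v = \<mu> *\<^sub>C v + c *\<^sub>C z"
      using that(2) by (simp add: algebra_simps)
    moreover from this have "cinner (X v) z = c"
      using that(1) by (simp add: cinner_add_left cinner_scaleC_left cinner_z_z)
    ultimately show ?thesis by simp
  qed
  then show ?thesis
    by (auto simp: eigenspace_on_def orth_compl_line compression_def P_proj_unit[OF unit] algebra_simps)
qed

lemma subspace_eigenspace_perp: "cvec.subspace (eigenspace_perp z X \<mu>)"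
  unfolding cvec.subspace_def
proof (intro conjI ballI allI)
  fix u v c assume "u \<in> eigenspace_perp z X \<mu>"
  then obtain a where u: "cinner u z = 0" "X u - \<mu> *\<^sub>C u = a *\<^sub>C z"
    unfolding eigenspace_perp_iff by blast
  have "X (c *\<^sub>C u) - \<mu> *\<^sub>C c *\<^sub>C u = c *\<^sub>C (X u - \<mu> *\<^sub>C u)"
    by (simp add: scale cvec.scale_left_commute[of \<mu>] cvec.scale_right_diff_distrib)
  then show "c *\<^sub>C u \<in> eigenspace_perp z X \<mu>"
    unfolding eigenspace_perp_iff u(2) using u(1) by (auto simp: cinner_scaleC_left)
  assume "v \<in> eigenspace_perp z X \<mu>"
  then obtain b where v: "cinner v z = 0" "X v - \<mu> *\<^sub>C v = b *\<^sub>C z"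
    unfolding eigenspace_perp_iff by blast
  have "X (u + v) - \<mu> *\<^sub>C (u + v) = (X u - \<mu> *\<^sub>C u) + (X v - \<mu> *\<^sub>C v)"
    by (simp add: add scaleC_add_right)
  then have "X (u + v) - \<mu> *\<^sub>C (u + v) = (a + b) *\<^sub>C z"
    unfolding u(2) v(2) scaleC_add_left .
  then show "u + v \<in> eigenspace_perp z X \<mu>"
    unfolding eigenspace_perp_iff using u(1) v(1) by (auto simp: cinner_add_left)
qed (auto simp: eigenspace_perp_iff intro: exI[of _ 0])

text \<open>
A vector \<open>v\<close> orthogonal to \<open>z\<close> is an eigenvector of the compression but not of \<open>X\<close> when \<open>(X - \<mu>)v\<close> is a
nonzero multiple of \<open>z\<close>; by \<open>shift_eq_multiple\<close> this forces \<open>F \<mu> = 0\<close>, and conversely \<open>res \<mu>\<close> is such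
a vector.
\<close>
lemma zero_of_F_iff:
  assumes "\<mu> \<notin> S"
  shows "F \<mu> = 0 \<longleftrightarrow> \<not> eigenspace_perp z X (of_real \<mu>) \<subseteq> eigenspace X (of_real \<mu>)"
proof
  assume "F \<mu> = 0"
  then have "res \<mu> \<in> eigenspace_perp z X (of_real \<mu>)"
    unfolding eigenspace_perp_iff using cinner_res shift_res[OF assms]
    by (auto intro!: exI[of _ 1] simp: scaleC_one)
  moreover have "res \<mu> \<notin> eigenspace X (of_real \<mu>)"
    using shift_res[OF assms] cinner_z_z by (auto simp: eigenspace_on_def)
  ultimately show "\<not> eigenspace_perp z X (of_real \<mu>) \<subseteq> eigenspace X (of_real \<mu>)"
    by blast
next
  assume "\<not> eigenspace_perp z X (of_real \<mu>) \<subseteq> eigenspace X (of_real \<mu>)"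
  then obtain v c where v: "cinner v z = 0" "X v - of_real \<mu> *\<^sub>C v = c *\<^sub>C z" "X v \<noteq> of_real \<mu> *\<^sub>C v"
    using eigenspace_perp_iff by (auto simp: eigenspace_on_def)
  then have "c \<noteq> 0" by auto
  then show "F \<mu> = 0"
    using shift_eq_multiple(1)[OF v(2) assms] v(1) by simp
qed

text \<open>
If \<open>\<mu>\<close> is not in the spectrum, \<open>zero_of_F_iff\<close> says that zeros of \<open>F\<close> are eigenvalues of the
compression. If it is an eigenvalue hidden from \<open>z\<close>, its eigenspace is contained in that of the
compression, and strict inclusion, that is membership in \<open>\<Delta>\<close>, is the criterion.
\<close>
lemma real_node_iff: "of_real \<mu> \<in> nodes z X \<longleftrightarrow> \<mu> \<in> S \<or> F \<mu> = 0"
proof (cases "\<mu> \<in> S")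
  case True
  then show ?thesis
    using visible_eigenvalue_iff unfolding nodes_def by blast
next
  case False
  let ?E = "eigenspace X (of_real \<mu>)" and ?E' = "eigenspace_perp z X (of_real \<mu>)"
  have "0 \<in> ?E" "0 \<in> ?E'"
    using cvec.subspace_0 subspace_eigenspace subspace_eigenspace_perp by blast+
  then have Spec: "of_real \<mu> \<in> Spec X \<longleftrightarrow> \<not> ?E \<subseteq> {0}" "of_real \<mu> \<in> Spec_perp z X \<longleftrightarrow> \<not> ?E' \<subseteq> {0}"
    unfolding Spec_on_def by blast+
  show ?thesis
  proof (cases "of_real \<mu> \<in> Spec X")
    case True
    then have hidden: "of_real \<mu> \<in> Gam_tilde z X"
      using False visible_eigenvalue_iff by blast
    have "?E \<subseteq> ?E'"
    proof
      fix v assume v: "v \<in> ?E"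
      then have "cinner v z = 0"
        using hidden cinner_eq_0_commute by (auto simp: Gam_tilde_def)
      with v show "v \<in> ?E'"
        unfolding eigenspace_perp_iff by (auto simp: eigenspace_on_def intro!: exI[of _ 0])
    qed
    then have "of_real \<mu> \<in> Delta z X \<longleftrightarrow> \<not> ?E' \<subseteq> ?E"
      using True Spec cvec_dim_less_iff[OF subspace_eigenspace subspace_eigenspace_perp]
      unfolding Delta_def by blast
    then show ?thesis
      using hidden False zero_of_F_iff[OF False] unfolding nodes_def by blast
  next
    case nonspec: False
    then have "?E = {0}"
      using Spec(1) \<open>0 \<in> ?E\<close> by blast
    then have "F \<mu> = 0 \<longleftrightarrow> of_real \<mu> \<in> Spec_perp z X"
      using zero_of_F_iff[OF False] Spec(2) by simp
    then show ?thesis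
      using nonspec False unfolding nodes_def Gam_tilde_def Delta_def by blast
  qed
qed

end

lemma spectral_vector_exists:
  assumes "self_adjoint X" "cnorm z = 1"
  obtains S g where "spectral_vector X z S g"
proof -
  interpret self_adjoint_op X
    by unfold_locales (rule assms(1))
  obtain S g where "finite S" "\<And>s. s \<in> S \<Longrightarrow> X (g s) = of_real s *\<^sub>C g s"
    "\<And>s. s \<in> S \<Longrightarrow> g s \<noteq> 0" "z = (\<Sum>s\<in>S. g s)"
    using spectral_decomposition[of z] by metis
  then have "spectral_vector X z S g"
    by unfold_locales (use assms(2) in auto)
  with that show ?thesis .
qed

section \<open>The curves of real pair-eigenvalues\<close>

locale operator_pair = A: spectral_vector A z S g + B: spectral_vector B z T h
  for A B :: "'h::fin_dim_hilbert \<Rightarrow> 'h" and z S g T h +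
  fixes \<kappa> :: real
  assumes \<kappa>: "\<kappa> \<noteq> 0"
begin

text \<open>
The factor \<open>\<kappa>\<^sup>2\<close> is absorbed into the weights of \<open>A\<close>, so that the equation of the curves becomes
symmetric.
\<close>
abbreviation wA :: "real \<Rightarrow> real"
  where "wA \<equiv> \<lambda>s. \<kappa>\<^sup>2 * A.weight s"

sublocale herglotz_pair S wA T B.weight
proof -
  interpret a: herglotz S A.weight by (rule A.herglotz)
  interpret b: herglotz T B.weight by (rule B.herglotz)
  show "herglotz_pair S wA T B.weight"
    by unfold_locales (use a.finite_S a.nonempty_S a.w_pos \<kappa> in auto)
qed

lemma relation_iff:
  "cos (left.angle \<alpha> + right.angle \<beta>) = 0 \<longleftrightarrow>
    (\<alpha> \<in> S \<and> \<beta> \<notin> T \<and> B.F \<beta> = 0) \<or> (\<alpha> \<notin> S \<and> A.F \<alpha> = 0 \<and> \<beta> \<in> T) \<or>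
    (\<alpha> \<notin> S \<and> \<beta> \<notin> T \<and> \<kappa>\<^sup>2 * A.F \<alpha> * B.F \<beta> = 1)"
  unfolding cos_angle_sum_iff pole_sum_scaled using \<kappa> by simp

lemma reduced_op_eq:
  assumes "of_real \<alpha> \<notin> Spec A"
  shows "reduced_op A B z \<kappa> (of_real \<alpha>) v = B v - (of_real (\<kappa>\<^sup>2 * A.F \<alpha>) * cinner v z) *\<^sub>C z"
  unfolding reduced_op_def P_proj_unit[OF A.unit] A.resolvent_z[OF assms]
  by (simp add: cinner_scaleC_left A.cinner_res scaleC_scaleC mult_ac)

text \<open>
The reduced operator is \<open>B\<close> minus a multiple of the projection onto \<open>z\<close>; an eigenvector orthogonal to \<open>z\<close> is one
of \<open>B\<close> and gives a constant branch, any other satisfies the equation of the curves.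
\<close>
lemma Spec_reduced_op_imp:
  assumes "of_real \<alpha> \<notin> Spec A" "of_real \<beta> \<in> Spec (reduced_op A B z \<kappa> (of_real \<alpha>))"
  shows "of_real \<beta> \<in> Gam z B \<or> cos (left.angle \<alpha> + right.angle \<beta>) = 0"
proof -
  let ?k = "\<kappa>\<^sup>2 * A.F \<alpha>"
  have "\<alpha> \<notin> S"
    using assms(1) A.visible_in_Spec by blast
  obtain v where v: "v \<noteq> 0" "B v - (of_real ?k * cinner v z) *\<^sub>C z = of_real \<beta> *\<^sub>C v"
    using assms(2) by (auto simp: Spec_on_def eigenspace_on_def reduced_op_eq[OF assms(1)])
  then have eq: "B v - of_real \<beta> *\<^sub>C v = (of_real ?k * cinner v z) *\<^sub>C z"
    by (simp add: algebra_simps)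
  show ?thesis
  proof (cases "cinner v z = 0")
    case True
    then show ?thesis
      using B.GamI[of v "of_real \<beta>"] v by simp
  next
    case nz: False
    show ?thesis
    proof (cases "\<beta> \<in> T")
      case True
      then have "A.F \<alpha> = 0"
        using B.shift_eq_multiple(2)[OF eq] nz \<kappa> by simp
      then show ?thesis
        unfolding relation_iff using True \<open>\<alpha> \<notin> S\<close> by blast
    next
      case False
      then have "cinner v z = (of_real ?k * cinner v z) * of_real (B.F \<beta>)"
        by (rule B.shift_eq_multiple(1)[OF eq])
      then have "cinner v z * of_real (?k * B.F \<beta> - 1) = 0"
        by (simp add: algebra_simps)
      then have "?k * B.F \<beta> = 1"
        using nz by (simp only: mult_eq_0_iff of_real_eq_0_iff) simp
      then show ?thesis
        unfolding relation_iff using False \<open>\<alpha> \<notin> S\<close> by blast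
    qed
  qed
qed

text \<open>
Explicit eigenvectors: \<open>h \<beta>\<close> at a pole, where \<open>F\<^sub>A(\<alpha>) = 0\<close> makes the perturbation vanish, and
\<open>B.res \<beta>\<close> elsewhere.
\<close>
lemma relation_imp_Spec_reduced_op:
  assumes "of_real \<alpha> \<notin> Spec A" "cos (left.angle \<alpha> + right.angle \<beta>) = 0"
  shows "of_real \<beta> \<in> Spec (reduced_op A B z \<kappa> (of_real \<alpha>))"
proof -
  have "\<alpha> \<notin> S"
    using assms(1) A.visible_in_Spec by blast
  then consider "A.F \<alpha> = 0" "\<beta> \<in> T" | "\<beta> \<notin> T" "\<kappa>\<^sup>2 * A.F \<alpha> * B.F \<beta> = 1"
    using assms(2) unfolding relation_iff by blast
  then have "\<exists>v. v \<noteq> 0 \<and> reduced_op A B z \<kappa> (of_real \<alpha>) v = of_real \<beta> *\<^sub>C v"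
  proof cases
    case 1
    then show ?thesis
      using B.eigen B.g_nonzero by (intro exI[of _ "h \<beta>"]) (simp add: reduced_op_eq[OF assms(1)])
  next
    case 2
    have eq: "B (B.res \<beta>) - of_real \<beta> *\<^sub>C B.res \<beta> = z"
      by (rule B.shift_res[OF 2(1)])
    then have "B.res \<beta> \<noteq> 0"
      using B.cinner_z_z by auto
    moreover have "(of_real (\<kappa>\<^sup>2 * A.F \<alpha>) * cinner (B.res \<beta>) z) *\<^sub>C z = z"
      unfolding B.cinner_res of_real_mult[symmetric] 2(2) by (simp add: scaleC_one)
    ultimately show ?thesis
      using eq by (intro exI[of _ "B.res \<beta>"]) (simp add: reduced_op_eq[OF assms(1)] algebra_simps)
  qed
  then show ?thesis
    by (auto simp: Spec_on_def eigenspace_on_def)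
qed

text \<open>
The system says that \<open>(A - \<alpha>)u\<close> and \<open>(B - \<beta>)v\<close> are the multiples \<open>-\<kappa>\<langle>v, z\<rangle>\<close> and \<open>-\<kappa>\<langle>u, z\<rangle>\<close> of \<open>z\<close>. Outside \<open>\<Gamma>\<^sub>A\<close> and
\<open>\<Gamma>\<^sub>B\<close> the two inner products cannot both vanish, and \<open>shift_eq_multiple\<close> relates them.
\<close>
lemma pair_eigenvalue_imp:
  assumes "pair_eigenvalue A B z \<kappa> (of_real \<alpha>) (of_real \<beta>)"
    and GamA: "of_real \<alpha> \<notin> Gam z A" and GamB: "of_real \<beta> \<notin> Gam z B"
  shows "cos (left.angle \<alpha> + right.angle \<beta>) = 0"
proof -
  obtain u v where uv: "(u, v) \<noteq> (0, 0)"
    and "(A u - of_real \<alpha> *\<^sub>C u) + of_real \<kappa> *\<^sub>C P_proj z v = 0"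
    and "of_real \<kappa> *\<^sub>C P_proj z u + (B v - of_real \<beta> *\<^sub>C v) = 0"
    using assms(1) unfolding pair_eigenvalue_def by blast
  then have A: "A u - of_real \<alpha> *\<^sub>C u = (- of_real \<kappa> * cinner v z) *\<^sub>C z"
    and B: "B v - of_real \<beta> *\<^sub>C v = (- of_real \<kappa> * cinner u z) *\<^sub>C z"
    unfolding P_proj_unit[OF A.unit] by (simp_all add: scaleC_scaleC add_eq_0_iff2 add_eq_0_iff)
  have u0: "u = 0" if "cinner u z = 0" "cinner v z = 0"
    using A.GamI[of u "of_real \<alpha>"] that A GamA by auto
  have v0: "v = 0" if "cinner u z = 0" "cinner v z = 0"
    using B.GamI[of v "of_real \<beta>"] that B GamB by auto
  have nz: "cinner u z \<noteq> 0 \<or> cinner v z \<noteq> 0"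
    using u0 v0 uv by blast
  have polA: "\<alpha> \<in> S \<Longrightarrow> cinner v z = 0" and polB: "\<beta> \<in> T \<Longrightarrow> cinner u z = 0"
    using A.shift_eq_multiple(2)[OF A] B.shift_eq_multiple(2)[OF B] \<kappa> by simp_all
  have regA: "\<alpha> \<notin> S \<Longrightarrow> cinner u z = - of_real \<kappa> * cinner v z * of_real (A.F \<alpha>)"
    and regB: "\<beta> \<notin> T \<Longrightarrow> cinner v z = - of_real \<kappa> * cinner u z * of_real (B.F \<beta>)"
    using A.shift_eq_multiple(1)[OF A] B.shift_eq_multiple(1)[OF B] by simp_all
  show ?thesis
  proof (cases "\<alpha> \<in> S")
    case True
    then have "\<beta> \<notin> T"
      using polA polB nz by blast
    moreover have "B.F \<beta> = 0"
      using regB[OF \<open>\<beta> \<notin> T\<close>] polA[OF True] nz \<kappa> by simp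
    ultimately show ?thesis
      unfolding relation_iff using True by blast
  next
    case False
    show ?thesis
    proof (cases "\<beta> \<in> T")
      case True
      then have "A.F \<alpha> = 0"
        using regA[OF False] polB[OF True] nz \<kappa> by simp
      then show ?thesis
        unfolding relation_iff using True False by blast
    next
      case nT: False
      have "cinner v z * of_real (\<kappa>\<^sup>2 * A.F \<alpha> * B.F \<beta> - 1) = 0"
        using regB[OF nT] unfolding regA[OF False] by (simp add: power2_eq_square algebra_simps)
      moreover have "cinner v z \<noteq> 0"
        using regA[OF False] nz by auto
      ultimately have "\<kappa>\<^sup>2 * A.F \<alpha> * B.F \<beta> = 1"
        by (simp only: mult_eq_0_iff of_real_eq_0_iff) simp
      then show ?thesis
        unfolding relation_iff using False nT by blast
    qed
  qed
qed

text \<open>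
The period \<open>total\<close> is a multiple of \<open>\<pi>\<close>, so the class of \<open>c\<close> modulo \<open>total\<close> retains the cosine equation.
\<close>
lemma cos_shift:
  assumes "cos c = 0"
  shows "cos (c + of_int n * right.total) = 0"
proof -
  have "of_int n * right.total = pi * of_int (n * int (card T))"
    by (simp add: right.total_def)
  then have "sin (of_int n * right.total) = 0"
    using sin_npi_int by metis
  with assms show ?thesis
    by (simp add: cos_add)
qed

lemma follows_relation:
  assumes "cos c = 0" "follows b c" "b \<alpha> = Some \<beta>"
  shows "cos (left.angle \<alpha> + right.angle \<beta>) = 0"
proof -
  obtain n where "left.angle \<alpha> + right.angle \<beta> = c + of_int n * right.total"
    using assms(2,3) unfolding follows_def by blast
  with cos_shift[OF assms(1)] show ?thesis by metis
qed

lemma follows_undefined_at_pole: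
  assumes "cos c = 0" "follows b c" "\<alpha> \<notin> dom b"
  shows "\<alpha> \<in> S"
proof -
  obtain n where "left.angle \<alpha> = c + of_int n * right.total"
    using assms(3) unfolding follows_None_iff[OF assms(2)] ..
  then have "cos (left.angle \<alpha>) = 0"
    using cos_shift[OF assms(1)] by metis
  then show ?thesis
    by (simp add: left.cos_angle_eq_0_iff)
qed

text \<open>
The normal form of the curves. From left to right this is \<open>continuous_selection_follows\<close>, with the eigenvalues
of \<open>A\<close> as exceptional points and \<open>\<Gamma>\<^sub>B\<close> as the set of constant branches; conversely a lift can be undefined only
at a pole of \<open>F\<^sub>A\<close>, which is an eigenvalue of \<open>A\<close>.
\<close>
lemma curve_iff: "curve A B z \<kappa> b \<longleftrightarrow> (\<exists>c. cos c = 0 \<and> follows b c)"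
proof
  assume "curve A B z \<kappa> b"
  then have select: "of_real \<alpha> \<notin> Spec A \<Longrightarrow> \<exists>\<beta>. b \<alpha> = Some \<beta> \<and>
         complex_of_real \<beta> \<in> Spec (reduced_op A B z \<kappa> (complex_of_real \<alpha>))"
    and cont: "continuous_on (dom b) (\<lambda>\<alpha>. the (b \<alpha>))"
    and blow: "\<alpha> \<notin> dom b \<Longrightarrow> filterlim (\<lambda>a. the (b a)) at_bot (at_left \<alpha>)"
       "\<alpha> \<notin> dom b \<Longrightarrow> filterlim (\<lambda>a. the (b a)) at_top (at_right \<alpha>)"
    and nc: "\<not> (\<exists>\<beta> l r. complex_of_real \<beta> \<in> Gam z B \<and> l < r \<and> (\<forall>\<alpha>\<in>{l<..<r}. b \<alpha> = Some \<beta>))" for \<alpha>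
    unfolding curve_def by blast+
  show "\<exists>c. cos c = 0 \<and> follows b c"
  proof (rule continuous_selection_follows[where E = "{\<alpha>. of_real \<alpha> \<in> Spec A}" and G = "{\<beta>. of_real \<beta> \<in> Gam z B}"])
    have "finite (complex_of_real -` Spec A)" "finite (complex_of_real -` Spec B)"
      using A.finite_Spec B.finite_Spec by (auto intro!: finite_vimageI simp: inj_def)
    then show "finite {\<alpha>. complex_of_real \<alpha> \<in> Spec A}" "finite {\<beta>. complex_of_real \<beta> \<in> Gam z B}"
      by (auto simp: vimage_def Gam_def elim: finite_subset[rotated])
    fix \<alpha> :: real assume "\<alpha> \<notin> {\<alpha>. of_real \<alpha> \<in> Spec A}"
    then show "\<exists>\<beta>. b \<alpha> = Some \<beta> \<and> (\<beta> \<in> {\<beta>. of_real \<beta> \<in> Gam z B} \<or> cos (left.angle \<alpha> + right.angle \<beta>) = 0)"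
      using select Spec_reduced_op_imp by blast
  qed (use cont blow nc in auto)
next
  assume "\<exists>c. cos c = 0 \<and> follows b c"
  then obtain c where c: "cos c = 0" "follows b c" by blast
  show "curve A B z \<kappa> b"
    unfolding curve_def
  proof (intro conjI allI impI)
    fix \<alpha> assume "complex_of_real \<alpha> \<notin> Spec A"
    moreover from this have "\<alpha> \<in> dom b"
      using follows_undefined_at_pole[OF c] A.visible_in_Spec by blast
    then obtain \<beta> where "b \<alpha> = Some \<beta>" by blast
    ultimately show "\<exists>\<beta>. b \<alpha> = Some \<beta> \<and> complex_of_real \<beta> \<in> Spec (reduced_op A B z \<kappa> (complex_of_real \<alpha>))"
      using relation_imp_Spec_reduced_op follows_relation[OF c] by blast
  next
    show "continuous_on (dom b) (\<lambda>\<alpha>. the (b \<alpha>))"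
      using follows_isCont[OF c(2)] by (blast intro: continuous_at_imp_continuous_on)
  next
    show "\<not> (\<exists>\<beta> l r. complex_of_real \<beta> \<in> Gam z B \<and> l < r \<and> (\<forall>\<alpha>\<in>{l<..<r}. b \<alpha> = Some \<beta>))"
      using follows_not_constant[OF c(2)] by blast
  qed (use follows_blowup[OF c(2)] in blast)+
qed

lemma curve_through:
  assumes "cos (left.angle \<alpha> + right.angle \<beta>) = 0"
  shows "\<exists>b\<in>curves A B z \<kappa>. b \<alpha> = Some \<beta>"
proof -
  obtain b where b: "follows b (left.angle \<alpha> + right.angle \<beta>)"
    using follows_exists by blast
  then have "b \<alpha> = Some \<beta>"
    unfolding follows_def by (auto intro: exI[of _ 0])
  with b assms show ?thesis
    unfolding curves_def curve_iff by blast
qed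

text \<open>
A curve with constant \<open>c\<close> is undefined at \<open>\<alpha>\<close> exactly if \<open>\<theta>\<^sub>A(\<alpha>) \<equiv> c\<close>; this fixes \<open>c\<close> modulo \<open>total\<close> and
thereby the curve.
\<close>
lemma unique_blowup:
  assumes "\<alpha> \<in> S"
  shows "\<exists>!b. b \<in> curves A B z \<kappa> \<and> filterlim (\<lambda>a. the (b a)) at_top (at_right \<alpha>) \<and>
    filterlim (\<lambda>a. the (b a)) at_bot (at_left \<alpha>)"
proof -
  obtain b where b: "follows b (left.angle \<alpha>)"
    using follows_exists by blast
  then have "\<alpha> \<notin> dom b"
    unfolding follows_None_iff[OF b] by (intro exI[of _ 0]) simp
  moreover have "b \<in> curves A B z \<kappa>"
    using b assms left.cos_angle_eq_0_iff unfolding curves_def curve_iff by blast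
  ultimately show ?thesis
  proof (intro ex1I[of _ b] conjI follows_blowup[OF b])
    fix b' assume b': "b' \<in> curves A B z \<kappa> \<and> filterlim (\<lambda>a. the (b' a)) at_top (at_right \<alpha>) \<and>
      filterlim (\<lambda>a. the (b' a)) at_bot (at_left \<alpha>)"
    then obtain c where c: "cos c = 0" "follows b' c"
      unfolding curves_def curve_iff by blast
    have "\<alpha> \<notin> dom b'"
    proof
      assume "\<alpha> \<in> dom b'"
      then have "((\<lambda>a. the (b' a)) \<longlongrightarrow> the (b' \<alpha>)) (at_right \<alpha>)"
        using follows_isCont[OF c(2)] by (simp add: isCont_def filterlim_at_split)
      then show False
        using b' not_tendsto_and_filterlim_at_infinity[of "at_right \<alpha>"] filterlim_at_top_imp_at_infinity
        by (metis trivial_limit_at_right_real)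
    qed
    then obtain n where "left.angle \<alpha> = c + of_int n * right.total"
      unfolding follows_None_iff[OF c(2)] ..
    then show "b' = b"
      using follows_unique[OF c(2) b] by blast
  qed
qed

text \<open>
Let \<open>p = \<kappa>\<^sup>2 F\<^sub>A(\<alpha>)\<close> and \<open>q = F\<^sub>B(\<beta>)\<close>, with derivatives \<open>\<kappa>\<^sup>2 a'\<close> and \<open>b'\<close>. The constancy of the sum of the angles
gives the slope \<open>- (\<kappa>\<^sup>2 a' / (1 + p\<^sup>2)) / (b' / (1 + q\<^sup>2))\<close>, and \<open>p q = 1\<close> simplifies it to
\<open>- \<kappa>\<^sup>2 a' q\<^sup>2 / b'\<close>.
\<close>
lemma derivative_formula:
  assumes "b \<in> curves A B z \<kappa>" "b \<alpha> = Some \<beta>" "of_real \<alpha> \<notin> Spec A" "of_real \<beta> \<notin> Spec B"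
  shows "\<exists>d. ((\<lambda>a. the (b a)) has_real_derivative d) (at \<alpha>) \<and>
    complex_of_real d = - complex_of_real (\<kappa>\<^sup>2) *
      (cinner (resolvent A (complex_of_real \<alpha>) (resolvent A (complex_of_real \<alpha>) z)) z *
       (cinner (resolvent B (complex_of_real \<beta>) z) z)\<^sup>2 /
       cinner (resolvent B (complex_of_real \<beta>) (resolvent B (complex_of_real \<beta>) z)) z) \<and> d < 0"
proof -
  obtain c where c: "cos c = 0" "follows b c"
    using assms(1) unfolding curves_def curve_iff by blast
  have out: "\<alpha> \<notin> S" "\<beta> \<notin> T"
    using assms(3,4) A.visible_in_Spec B.visible_in_Spec by blast+
  define a' where "a' = pole_sum_deriv S A.weight \<alpha>"
  define b' where "b' = pole_sum_deriv T B.weight \<beta>"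
  let ?a = "A.F \<alpha>" and ?b = "B.F \<beta>"
  have pos: "0 < a'" "0 < b'"
    using herglotz.f'_pos[OF A.herglotz out(1)] herglotz.f'_pos[OF B.herglotz out(2)]
    by (simp_all add: a'_def b'_def)
  have rel: "\<kappa>\<^sup>2 * ?a * ?b = 1"
    using follows_relation[OF c assms(2)] out unfolding relation_iff by blast
  then have "?b \<noteq> 0" by auto
  let ?d = "- \<kappa>\<^sup>2 * (a' * ?b\<^sup>2 / b')"
  have ka: "\<kappa>\<^sup>2 * ?a = 1 / ?b"
    using rel \<open>?b \<noteq> 0\<close> by (simp add: field_simps)
  have nz: "1 + ?b\<^sup>2 \<noteq> 0" "1 + (1 / ?b)\<^sup>2 \<noteq> 0"
    by (metis add_pos_nonneg less_irrefl zero_le_power2 zero_less_one)+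
  have "1 + (1 / ?b)\<^sup>2 = (1 + ?b\<^sup>2) / ?b\<^sup>2"
    using \<open>?b \<noteq> 0\<close> by (simp add: field_simps)
  then have d: "inverse (b' / (1 + ?b\<^sup>2)) * - (\<kappa>\<^sup>2 * a' / (1 + (1 / ?b)\<^sup>2)) = ?d"
    using nz pos \<open>?b \<noteq> 0\<close> by simp
  have "((\<lambda>a. the (b a)) has_real_derivative ?d) (at \<alpha>)"
    using follows_has_derivative[OF c(2) assms(2) out]
    unfolding pole_sum_scaled ka a'_def[symmetric] b'_def[symmetric] d .
  moreover have "?d < 0"
    using pos \<kappa> \<open>?b \<noteq> 0\<close> by (simp add: divide_pos_pos)
  moreover have "complex_of_real ?d = - complex_of_real (\<kappa>\<^sup>2) *
      (cinner (resolvent A (complex_of_real \<alpha>) (resolvent A (complex_of_real \<alpha>) z)) z *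
       (cinner (resolvent B (complex_of_real \<beta>) z) z)\<^sup>2 /
       cinner (resolvent B (complex_of_real \<beta>) (resolvent B (complex_of_real \<beta>) z)) z)"
    unfolding A.resolvent_z_z[OF assms(3)] B.resolvent_z_z[OF assms(4)] a'_def b'_def by simp
  ultimately show ?thesis by blast
qed

lemma enumerates_nodes:
  shows "enumerates x m (nodes z A) \<Longrightarrow> enumerates x m (complex_of_real ` {r. r \<in> S \<or> left.f r = 0})"
    and "enumerates y n (nodes z B) \<Longrightarrow> enumerates y n (complex_of_real ` {r. r \<in> T \<or> right.f r = 0})"
proof -
  have "{r. complex_of_real r \<in> nodes z A} = {r. r \<in> S \<or> left.f r = 0}"
    "{r. complex_of_real r \<in> nodes z B} = {r. r \<in> T \<or> right.f r = 0}"
    unfolding A.real_node_iff B.real_node_iff pole_sum_scaled using \<kappa> by simp_all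
  then show "enumerates x m (nodes z A) \<Longrightarrow> enumerates x m (complex_of_real ` {r. r \<in> S \<or> left.f r = 0})"
    and "enumerates y n (nodes z B) \<Longrightarrow> enumerates y n (complex_of_real ` {r. r \<in> T \<or> right.f r = 0})"
    unfolding enumerates_def by (simp_all add: image_iff)
qed

end

context operator_pair
begin

context
  fixes x y :: "nat \<Rightarrow> ereal" and m n :: nat and \<alpha> \<beta> :: real and b
  assumes x: "enumerates x m (nodes z A)" and y: "enumerates y n (nodes z B)"
    and b: "b \<in> curves A B z \<kappa>" "b \<alpha> = Some \<beta>"
begin

lemma angle_sum_odd:
  obtains k :: int where "odd k" "left.angle \<alpha> / (pi / 2) + right.angle \<beta> / (pi / 2) = of_int k"
proof -
  obtain c where "cos c = 0" "follows b c"
    using b(1) unfolding curves_def curve_iff by blast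
  then have "cos (left.angle \<alpha> + right.angle \<beta>) = 0"
    using follows_relation b(2) by blast
  then obtain k where "odd k" "left.angle \<alpha> + right.angle \<beta> = of_int k * (pi / 2)"
    unfolding cos_zero_iff_int by blast
  then show ?thesis
    by (intro that[of k]) (simp_all add: add_divide_distrib[symmetric])
qed

lemma left_strip:
  assumes "p \<in> {1..m + 1}" "x (p - 1) < ereal \<alpha>" "ereal \<alpha> < x p"
  shows "real p - 1 < left.angle \<alpha> / (pi / 2)" "left.angle \<alpha> / (pi / 2) < real p"
  using assms left.enumerated_angles[OF enumerates_nodes(1)[OF x]]
  by (auto simp: field_simps of_nat_diff)

lemma right_strip:
  assumes "q \<in> {1..n + 1}" "y (q - 1) < ereal \<beta>" "ereal \<beta> < y q"
  shows "real q - 1 < right.angle \<beta> / (pi / 2)" "right.angle \<beta> / (pi / 2) < real q"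
  using assms right.enumerated_angles[OF enumerates_nodes(2)[OF y]]
  by (auto simp: field_simps of_nat_diff)

lemma left_node:
  assumes "i \<in> {1..m}" "ereal \<alpha> = x i"
  shows "left.angle \<alpha> / (pi / 2) = real i"
proof -
  have "\<not> x i < ereal \<alpha>" "\<not> ereal \<alpha> < x i" "i \<le> m + 1"
    using assms by auto
  then have "left.angle \<alpha> = real i * (pi / 2)"
    using left.enumerated_angles[OF enumerates_nodes(1)[OF x], of i \<alpha>] by linarith
  then show ?thesis by simp
qed

lemma right_node:
  assumes "j \<in> {1..n}" "ereal \<beta> = y j"
  shows "right.angle \<beta> / (pi / 2) = real j"
proof -
  have "\<not> y j < ereal \<beta>" "\<not> ereal \<beta> < y j" "j \<le> n + 1"
    using assms by auto
  then have "right.angle \<beta> = real j * (pi / 2)"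
    using right.enumerated_angles[OF enumerates_nodes(2)[OF y], of j \<beta>] by linarith
  then show ?thesis by simp
qed

text \<open>
In units of \<open>\<pi>/2\<close> the two angles lie in \<open>(p - 1, p)\<close> and \<open>(q - 1, q)\<close>, so their sum, an odd integer, is
\<open>p + q - 1\<close>.
\<close>
lemma curve_in_rect:
  assumes "p \<in> {1..m + 1}" "q \<in> {1..n + 1}" "(\<alpha>, \<beta>) \<in> rect x y p q"
  shows "even (p + q)"
proof -
  obtain k :: int where k: "odd k" "left.angle \<alpha> / (pi / 2) + right.angle \<beta> / (pi / 2) = of_int k"
    by (rule angle_sum_odd)
  have "real p - 1 < left.angle \<alpha> / (pi / 2)" "left.angle \<alpha> / (pi / 2) < real p"
    "real q - 1 < right.angle \<beta> / (pi / 2)" "right.angle \<beta> / (pi / 2) < real q"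
    using left_strip[of p] right_strip[of q] assms by (simp_all add: rect_def)
  then have "of_int (int p + int q - 2) < (of_int k :: real)" "(of_int k :: real) < of_int (int p + int q)"
    using k(2) by simp_all
  then have "k = int p + int q - 1"
    by linarith
  with k(1) show ?thesis by simp
qed

text \<open>
In units of \<open>\<pi>/2\<close> the angles add up to an integer, so when one of them is an integer both are; an
angle strictly between consecutive integers is therefore impossible on a grid line.
\<close>
lemma curve_at_corner:
  assumes "\<And>p q. p \<in> {1..m + 1} \<Longrightarrow> q \<in> {1..n + 1} \<Longrightarrow> (\<alpha>, \<beta>) \<notin> rect x y p q"
  shows "\<exists>i\<in>{1..m}. \<exists>j\<in>{1..n}. ereal \<alpha> = x i \<and> ereal \<beta> = y j \<and> odd (i + j)"
proof -
  obtain k :: int where k: "odd k" "left.angle \<alpha> / (pi / 2) + right.angle \<beta> / (pi / 2) = of_int k"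
    by (rule angle_sum_odd)
  show ?thesis
  proof (cases rule: left.enumerated_position[OF enumerates_nodes(1)[OF x], of \<alpha>])
    case (1 p)
    note p = left_strip[OF 1]
    show ?thesis
    proof (cases rule: right.enumerated_position[OF enumerates_nodes(2)[OF y], of \<beta>])
      case q: (1 q)
      then show ?thesis
        using assms[of p q] 1 by (simp add: rect_def)
    next
      case (2 j)
      have "of_int (int p - 1) < (of_int (k - int j) :: real)" "(of_int (k - int j) :: real) < of_int (int p)"
        using p k(2) right_node[OF 2] by simp_all
      then have False unfolding of_int_less_iff by linarith
      then show ?thesis ..
    qed
  next
    case (2 i)
    note i = left_node[OF 2]
    show ?thesis
    proof (cases rule: right.enumerated_position[OF enumerates_nodes(2)[OF y], of \<beta>])
      case (1 q)
      have "of_int (int q - 1) < (of_int (k - int i) :: real)" "(of_int (k - int i) :: real) < of_int (int q)"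
        using i k(2) right_strip[OF 1] by simp_all
      then have False unfolding of_int_less_iff by linarith
      then show ?thesis ..
    next
      case j: (2 j)
      have "(of_int (int i + int j) :: real) = of_int k"
        using i k(2) right_node[OF j] by simp
      then have "k = int (i + j)"
        unfolding of_int_eq_iff by simp
      then have "odd (i + j)"
        using k(1) by (simp only: even_of_nat_iff not_False_eq_True)
      with 2 j show ?thesis by blast
    qed
  qed
qed

end

lemma curve_continuity:
  assumes "b \<in> curves A B z \<kappa>"
  shows "\<alpha> \<in> dom b \<Longrightarrow> isCont (\<lambda>a. the (b a)) \<alpha>"
    and "\<alpha> \<notin> dom b \<Longrightarrow> of_real \<alpha> \<in> Spec A - Gam_tilde z A"
    and "l < r \<Longrightarrow> {l..r} \<subseteq> dom b \<Longrightarrow> the (b r) < the (b l)"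
proof -
  obtain c where c: "cos c = 0" "follows b c"
    using assms unfolding curves_def curve_iff by blast
  show "\<alpha> \<in> dom b \<Longrightarrow> isCont (\<lambda>a. the (b a)) \<alpha>"
    by (rule follows_isCont[OF c(2)])
  show "\<alpha> \<notin> dom b \<Longrightarrow> of_real \<alpha> \<in> Spec A - Gam_tilde z A"
    unfolding A.visible_eigenvalue_iff by (rule follows_undefined_at_pole[OF c])
  show "l < r \<Longrightarrow> {l..r} \<subseteq> dom b \<Longrightarrow> the (b r) < the (b l)"
    by (rule follows_decreasing[OF c(2)])
qed

end

theorem theorem2p5:
  fixes A B :: "'h::fin_dim_hilbert \<Rightarrow> 'h" and z :: 'h and \<kappa> :: real
    and s t :: nat and x y :: "nat \<Rightarrow> ereal"
  assumes "self_adjoint A" and "self_adjoint B"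
    and "cnorm z = 1" and "\<kappa> \<noteq> 0"
    and "Gam z A \<noteq> {} \<or> Gam z B \<noteq> {}"
    and "enumerates x s (nodes z A)" and "enumerates y t (nodes z B)"
  shows
    \<comment> \<open>location of the real pair-eigenvalues\<close>
    "(\<forall>\<alpha> \<beta> :: real. pair_eigenvalue A B z \<kappa> (complex_of_real \<alpha>) (complex_of_real \<beta>) \<longrightarrow>
        complex_of_real \<alpha> \<in> Gam z A \<or> complex_of_real \<beta> \<in> Gam z B \<or>
        (\<exists>b \<in> curves A B z \<kappa>. b \<alpha> = Some \<beta>))
    \<comment> \<open>(a)\<close>
    \<and> (\<forall>b \<in> curves A B z \<kappa>. \<forall>\<alpha> \<beta>. \<forall>p \<in> {1..s + 1}. \<forall>q \<in> {1..t + 1}.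
        b \<alpha> = Some \<beta> \<and> (\<alpha>, \<beta>) \<in> rect x y p q \<longrightarrow> even (p + q))
    \<comment> \<open>(b)\<close>
    \<and> (\<forall>b \<in> curves A B z \<kappa>. \<forall>\<alpha> \<beta>.
        b \<alpha> = Some \<beta> \<and> (\<forall>p \<in> {1..s + 1}. \<forall>q \<in> {1..t + 1}. (\<alpha>, \<beta>) \<notin> rect x y p q) \<longrightarrow>
        (\<exists>i \<in> {1..s}. \<exists>j \<in> {1..t}. ereal \<alpha> = x i \<and> ereal \<beta> = y j \<and> odd (i + j)))
    \<comment> \<open>(c)\<close>
    \<and> (\<forall>b \<in> curves A B z \<kappa>.
        (\<forall>\<alpha> \<in> dom b. isCont (\<lambda>a. the (b a)) \<alpha>) \<and>
        (\<forall>\<alpha>. \<alpha> \<notin> dom b \<longrightarrow> complex_of_real \<alpha> \<in> Spec A - Gam_tilde z A))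
    \<and> (\<forall>\<alpha>. complex_of_real \<alpha> \<in> Spec A - Gam_tilde z A \<longrightarrow>
        (\<exists>!b. b \<in> curves A B z \<kappa> \<and>
          filterlim (\<lambda>a. the (b a)) at_top (at_right \<alpha>) \<and>
          filterlim (\<lambda>a. the (b a)) at_bot (at_left \<alpha>)))
    \<comment> \<open>(d)\<close>
    \<and> (\<forall>b \<in> curves A B z \<kappa>.
        (\<forall>l r. l < r \<and> {l..r} \<subseteq> dom b \<longrightarrow> the (b r) < the (b l)) \<and>
        (\<forall>\<alpha> \<beta>. b \<alpha> = Some \<beta> \<and> complex_of_real \<alpha> \<notin> Spec A \<and> complex_of_real \<beta> \<notin> Spec B \<longrightarrow>
          (\<exists>d. ((\<lambda>a. the (b a)) has_real_derivative d) (at \<alpha>) \<and>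
            complex_of_real d = - complex_of_real (\<kappa>\<^sup>2) *
              (cinner (resolvent A (complex_of_real \<alpha>) (resolvent A (complex_of_real \<alpha>) z)) z *
               (cinner (resolvent B (complex_of_real \<beta>) z) z)\<^sup>2 /
               cinner (resolvent B (complex_of_real \<beta>) (resolvent B (complex_of_real \<beta>) z)) z) \<and>
            d < 0)))"
proof -
  obtain S g where A: "spectral_vector A z S g"
    using spectral_vector_exists[OF assms(1,3)] by blast
  obtain T h where B: "spectral_vector B z T h"
    using spectral_vector_exists[OF assms(2,3)] by blast
  interpret A: spectral_vector A z S g by (rule A)
  interpret B: spectral_vector B z T h by (rule B)
  interpret operator_pair A B z S g T h \<kappa>
    by unfold_locales (rule assms(4))
  note enum = assms(6,7)
  show ?thesis
  proof (intro conjI)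
    show "\<forall>\<alpha> \<beta> :: real. pair_eigenvalue A B z \<kappa> (complex_of_real \<alpha>) (complex_of_real \<beta>) \<longrightarrow>
        complex_of_real \<alpha> \<in> Gam z A \<or> complex_of_real \<beta> \<in> Gam z B \<or>
        (\<exists>b \<in> curves A B z \<kappa>. b \<alpha> = Some \<beta>)"
      using pair_eigenvalue_imp curve_through by blast
  next
    show "\<forall>b \<in> curves A B z \<kappa>. \<forall>\<alpha> \<beta>. \<forall>p \<in> {1..s + 1}. \<forall>q \<in> {1..t + 1}.
        b \<alpha> = Some \<beta> \<and> (\<alpha>, \<beta>) \<in> rect x y p q \<longrightarrow> even (p + q)"
      using curve_in_rect[OF enum] by blast
  next
    show "\<forall>b \<in> curves A B z \<kappa>. \<forall>\<alpha> \<beta>.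
        b \<alpha> = Some \<beta> \<and> (\<forall>p \<in> {1..s + 1}. \<forall>q \<in> {1..t + 1}. (\<alpha>, \<beta>) \<notin> rect x y p q) \<longrightarrow>
        (\<exists>i \<in> {1..s}. \<exists>j \<in> {1..t}. ereal \<alpha> = x i \<and> ereal \<beta> = y j \<and> odd (i + j))"
      using curve_at_corner[OF enum] by blast
  next
    show "\<forall>b \<in> curves A B z \<kappa>.
        (\<forall>\<alpha> \<in> dom b. isCont (\<lambda>a. the (b a)) \<alpha>) \<and>
        (\<forall>\<alpha>. \<alpha> \<notin> dom b \<longrightarrow> complex_of_real \<alpha> \<in> Spec A - Gam_tilde z A)"
      using curve_continuity(1,2) by blast
  next
    show "\<forall>\<alpha>. complex_of_real \<alpha> \<in> Spec A - Gam_tilde z A \<longrightarrow>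
        (\<exists>!b. b \<in> curves A B z \<kappa> \<and>
          filterlim (\<lambda>a. the (b a)) at_top (at_right \<alpha>) \<and>
          filterlim (\<lambda>a. the (b a)) at_bot (at_left \<alpha>))"
      unfolding A.visible_eigenvalue_iff by (intro allI impI unique_blowup)
  next
    show "\<forall>b \<in> curves A B z \<kappa>.
        (\<forall>l r. l < r \<and> {l..r} \<subseteq> dom b \<longrightarrow> the (b r) < the (b l)) \<and>
        (\<forall>\<alpha> \<beta>. b \<alpha> = Some \<beta> \<and> complex_of_real \<alpha> \<notin> Spec A \<and> complex_of_real \<beta> \<notin> Spec B \<longrightarrow>
          (\<exists>d. ((\<lambda>a. the (b a)) has_real_derivative d) (at \<alpha>) \<and>
            complex_of_real d = - complex_of_real (\<kappa>\<^sup>2) *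
              (cinner (resolvent A (complex_of_real \<alpha>) (resolvent A (complex_of_real \<alpha>) z)) z *
               (cinner (resolvent B (complex_of_real \<beta>) z) z)\<^sup>2 /
               cinner (resolvent B (complex_of_real \<beta>) (resolvent B (complex_of_real \<beta>) z)) z) \<and>
            d < 0))"
      using curve_continuity(3) derivative_formula by (intro ballI conjI allI impI) (elim conjE, blast)+
  qed
qed

end
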